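(* For every $n\ge1$ the triangular ladder $TL_n$ is semi-symmetrized $e$-positive; consequently its chromatic symmetric function $X_{TL_n}$ is $e$-positive.
   Context: $TL_n$ ($=P_{n,2}$) is the graph on vertex set $[n]$ with an edge between $i,j$ exactly when $1\le|i-j|\le2$. For a simple graph $G$ on $[n]$, $Y_G=\sum_\kappa x_{\kappa(1)}\cdots x_{\kappa(n)}$ in non-commuting variables $x_1,x_2,\dots$, summed over proper colorings $\kappa:[n]\to\{1,2,\dots\}$, and $X_G$ is the same sum with commuting variables (Stanley's chromatic symmetric function). For $\pi\vdash[n]$, $e_\pi=\sum x_{i_1}\cdots x_{i_n}$ (non-commuting) over tuples with $i_j\ne i_k$ whenever $j\ne k$ are in a common block. For $\pi,\sigma\vdash[n]$, $\pi\sim\sigma$ if they have the same multiset of block sizes and the block of $\pi$ containing $n$ has the same size as that of $\sigma$ containing $n$; for homogeneous degree-$n$ $f,g$, $f\equiv_n g$ means that for each $\sim$-class the sums of $e$-coefficients of $f$ and of $g$ over the class coincide. $f$ is semi-symmetrized $e$-positive if $f\equiv_n g$ for some $g$ that is a nonnegative linear combination of the $e_\pi$; a graph $G$ on $[n]$ is semi-symmetrized $e$-positive if $Y_G$ is. A symmetric function in commuting variables is $e$-positive if it is a nonnegative linear combination of the elementary symmetric functions $e_\lambda$. *)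

theory Defs
  imports Complex_Main "HOL-Library.Disjoint_Sets" "HOL-Library.Multiset"
begin

text \<open>Degree-n elements of the ring of formal power series in non-commuting
variables x_1, x_2, ... are represented by their coefficient functions on words:
a word (monomial) x_{i_1} ... x_{i_n} is the list [i_1, ..., i_n] with all i_j \<ge> 1.
Position j of the word corresponds to vertex j+1 of [n] = {1..n}.\<close>

type_synonym ncfun = "nat list \<Rightarrow> real"

definition is_word :: "nat \<Rightarrow> nat list \<Rightarrow> bool" where
  "is_word n w \<longleftrightarrow> length w = n \<and> 0 \<notin> set w"

text \<open>Simple graphs on [n]: a symmetric irreflexive relation E on nat (only
vertices in {1..n} matter).\<close>

definition TL :: "nat \<Rightarrow> nat \<Rightarrow> nat \<Rightarrow> bool" where
  "TL n i j \<longleftrightarrow> i \<in> {1..n} \<and> j \<in> {1..n} \<and> 1 \<le> nat \<bar>int i - int j\<bar> \<and> nat \<bar>int i - int j\<bar> \<le> 2"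

definition proper_word :: "nat \<Rightarrow> (nat \<Rightarrow> nat \<Rightarrow> bool) \<Rightarrow> nat list \<Rightarrow> bool" where
  "proper_word n E w \<longleftrightarrow> (\<forall>i\<in>{1..n}. \<forall>j\<in>{1..n}. E i j \<longrightarrow> w ! (i - 1) \<noteq> w ! (j - 1))"

text \<open>Y_G: sum over proper colorings of the (non-commuting) monomials.\<close>
definition Y_G :: "nat \<Rightarrow> (nat \<Rightarrow> nat \<Rightarrow> bool) \<Rightarrow> ncfun" where
  "Y_G n E w = (if is_word n w \<and> proper_word n E w then 1 else 0)"

definition setparts :: "nat \<Rightarrow> nat set set set" where
  "setparts n = {P. partition_on {1..n} P}"

definition e_pi :: "nat \<Rightarrow> nat set set \<Rightarrow> ncfun" where
  "e_pi n P w = (if is_word n w \<and>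
      (\<forall>B\<in>P. \<forall>j\<in>B. \<forall>k\<in>B. j \<noteq> k \<longrightarrow> w ! (j - 1) \<noteq> w ! (k - 1)) then 1 else 0)"

definition block_of :: "nat set set \<Rightarrow> nat \<Rightarrow> nat set" where
  "block_of P x = (THE B. B \<in> P \<and> x \<in> B)"

definition sim_part :: "nat \<Rightarrow> nat set set \<Rightarrow> nat set set \<Rightarrow> bool" where
  "sim_part n P Q \<longleftrightarrow> image_mset card (mset_set P) = image_mset card (mset_set Q)
      \<and> card (block_of P n) = card (block_of Q n)"

definition e_expansion :: "nat \<Rightarrow> ncfun \<Rightarrow> (nat set set \<Rightarrow> real) \<Rightarrow> bool" where
  "e_expansion n f c \<longleftrightarrow> f = (\<lambda>w. \<Sum>P\<in>setparts n. c P * e_pi n P w)"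

text \<open>f \<equiv>_n g, for f, g with e-coefficients c and d respectively.\<close>
definition equiv_coeffs :: "nat \<Rightarrow> (nat set set \<Rightarrow> real) \<Rightarrow> (nat set set \<Rightarrow> real) \<Rightarrow> bool" where
  "equiv_coeffs n c d \<longleftrightarrow> (\<forall>Q\<in>setparts n.
      (\<Sum>P\<in>{P\<in>setparts n. sim_part n P Q}. c P) = (\<Sum>P\<in>{P\<in>setparts n. sim_part n P Q}. d P))"

definition semi_sym_e_positive :: "nat \<Rightarrow> ncfun \<Rightarrow> bool" where
  "semi_sym_e_positive n f \<longleftrightarrow> (\<exists>c d. e_expansion n f c \<and> (\<forall>P. 0 \<le> d P) \<and> equiv_coeffs n c d)"

text \<open>Commutative symmetric functions of degree n: coefficient functions on
monomials, a monomial being a multiset of variable indices (all \<ge> 1).\<close>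

type_synonym cfun = "nat multiset \<Rightarrow> real"

definition X_G :: "nat \<Rightarrow> (nat \<Rightarrow> nat \<Rightarrow> bool) \<Rightarrow> cfun" where
  "X_G n E m = real (card {w. is_word n w \<and> proper_word n E w \<and> mset w = m})"

definition int_partition :: "nat \<Rightarrow> nat list \<Rightarrow> bool" where
  "int_partition n l \<longleftrightarrow> sum_list l = n \<and> 0 \<notin> set l \<and> sorted_wrt (\<ge>) l"

text \<open>e_lambda = e_{lambda_1} ... e_{lambda_l}: the coefficient of the monomial m is
the number of tuples (S_1,...,S_l) of sets of variable indices with |S_i| = lambda_i
whose product of monomials is m.\<close>
definition e_lambda :: "nat list \<Rightarrow> cfun" where
  "e_lambda l m = real (card {Ss :: nat set list. length Ss = length l \<and>
      (\<forall>i<length l. finite (Ss ! i) \<and> card (Ss ! i) = l ! i \<and> 0 \<notin> Ss ! i) \<and>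
      sum_list (map mset_set Ss) = m})"

definition e_positive :: "nat \<Rightarrow> cfun \<Rightarrow> bool" where
  "e_positive n f \<longleftrightarrow> (\<exists>c. (\<forall>l. 0 \<le> c l) \<and>
      f = (\<lambda>m. \<Sum>l\<in>{l. int_partition n l}. c l * e_lambda l m))"

end

theory Submission
  imports Defs "HOL-Library.FuncSet" "HOL-Library.Poly_Mapping"
    "HOL-Computational_Algebra.Fundamental_Theorem_Algebra"
begin

text \<open>
  Fix complex weights t on a finite alphabet A. Modulo reordering of the first n - 1 letters,
  a noncommutative function is determined by the sums of its weighted words with prescribed
  last letter x, and e_pi then becomes a multiple of a product of elementary symmetric
  functions e_l(A) with t(x) e_{b-1}(A - {x}), where b is the size of the block of n.
  These products are linearly independent, because weights with prescribed values of
  t(x), e_1, ..., e_n exist by the fundamental theorem of algebra. So it suffices to expand the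
  generating function of the proper words ending in x with nonnegative coefficients.

  Let W_n(y, x) be the generating function of the proper words ending in y, x. Then
  W_{n+1}(y, x) is t(x) times the sum of W_n(a, y) over a different from x and y. Positivity
  propagates through this recursion for the following cone: it contains t(y) t(x) e_k(A - {x, y})
  and the combinations, with superincreasing coefficients M_i, of the functions
  B(a, b) = t(y) e_a(A - {y}) t(x) e_b(A - {x}) in which (a, b) has evolved from (i, 0) by
  (a, b) \<mapsto> (b, a + 1). In every step the coefficient M_i of the function started at i = N - 2k
  pays for the negative terms e_{N+1-k} e_k(A - {x}) caused by all functions started
  before i, and the superincreasing sequence is prolonged by the sum of all its terms.
\<close>

section \<open>Elementary symmetric functions with a marked letter\<close>

text \<open>The obstacle is the exclusion a = x in the recursion: it subtracts t(x) B(a, b), taken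
  with first letter x and last letter y. Since t(x) e_a(A - {x}) = e_{a+1}(A) - e_{a+1}(A - {x}),
  this subtraction equals a multiple of e_{a+1}(A), cancelled by the sum over all letters, minus a
  function B(b, a + 1) that therefore enters with a plus sign. This is the origin of (a, b)
  \<mapsto> (b, a + 1). The sum over all letters also produces e_{a+1}(A - {y}) e_b(A - {y}), whose
  expansion has negative coefficients for a single B(a, b); so the functions B can only be handled
  in weighted families.

  Two matters are independent of positivity. The notion of semi-symmetrized positivity asks for an
  actual e-expansion of Y_G, so one is constructed: inclusion-exclusion over the edges gives
  indicators of words that are constant on blocks, and a triangular system converts these to the
  e_pi. The commutative statement uses other weights than the complex ones: the identities for
  \<open>esym\<close> hold over every commutative ring, in particular over a monoid algebra of
  multisets.\<close>

definition esym :: "'b set \<Rightarrow> ('b \<Rightarrow> 'a::comm_ring_1) \<Rightarrow> nat \<Rightarrow> 'a" where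
  "esym A t k = (\<Sum>S | S \<subseteq> A \<and> card S = k. \<Prod>a\<in>S. t a)"

lemma esym_0 [simp]:
  assumes "finite A"
  shows "esym A t 0 = 1"
proof -
  have "{S. S \<subseteq> A \<and> card S = 0} = {{}}"
    using assms by (auto dest: finite_subset)
  then show ?thesis by (simp add: esym_def)
qed

lemma esym_eq_0:
  assumes "finite A" "card A < k"
  shows "esym A t k = 0"
proof -
  have "{S. S \<subseteq> A \<and> card S = k} = {}"
    using card_mono[OF assms(1)] assms(2) by (auto simp: not_less[symmetric])
  then show ?thesis unfolding esym_def by (simp only: sum.empty)
qed

lemma esym_insert:
  assumes "finite A" "a \<notin> A"
  shows "esym (insert a A) t (Suc k) = esym A t (Suc k) + t a * esym A t k"
proof -
  let ?U = "{S. S \<subseteq> A \<and> card S = Suc k}" and ?V = "{S. S \<subseteq> A \<and> card S = k}"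
  have split: "{S. S \<subseteq> insert a A \<and> card S = Suc k} = ?U \<union> insert a ` ?V"
  proof (intro equalityI subsetI)
    fix S assume S: "S \<in> {S. S \<subseteq> insert a A \<and> card S = Suc k}"
    show "S \<in> ?U \<union> insert a ` ?V"
    proof (cases "a \<in> S")
      case True
      have "finite S" using S assms(1) by (auto intro: finite_subset)
      then have "S - {a} \<in> ?V" using S True by auto
      moreover have "S = insert a (S - {a})" using True by auto
      ultimately show ?thesis by blast
    qed (use S in auto)
  next
    fix S assume "S \<in> ?U \<union> insert a ` ?V"
    then show "S \<in> {S. S \<subseteq> insert a A \<and> card S = Suc k}"
    proof
      assume "S \<in> insert a ` ?V"
      then obtain R where R: "R \<subseteq> A" "card R = k" "S = insert a R" by auto
      moreover have "finite R" "a \<notin> R" using R assms by (auto intro: finite_subset)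
      ultimately show ?thesis by auto
    qed auto
  qed
  have inj: "inj_on (insert a) ?V"
    using assms(2) by (intro inj_onI) (auto simp: insert_eq_iff dest: set_mp)
  have "esym (insert a A) t (Suc k) = (\<Sum>S\<in>?U. \<Prod>a\<in>S. t a) + (\<Sum>S\<in>insert a ` ?V. \<Prod>a\<in>S. t a)"
    unfolding esym_def split
    by (rule sum.union_disjoint) (use assms in auto)
  also have "(\<Sum>S\<in>insert a ` ?V. \<Prod>a\<in>S. t a) = (\<Sum>S\<in>?V. \<Prod>a\<in>insert a S. t a)"
    by (subst sum.reindex[OF inj]) simp
  also have "\<dots> = (\<Sum>S\<in>?V. t a * (\<Prod>a\<in>S. t a))"
    using assms by (intro sum.cong refl prod.insert) (auto intro: finite_subset)
  finally show ?thesis by (simp add: esym_def sum_distrib_left)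
qed

lemma esym_remove:
  assumes "finite A" "a \<in> A"
  shows "esym A t (Suc k) = esym (A - {a}) t (Suc k) + t a * esym (A - {a}) t k"
  using esym_insert[of "A - {a}" a t k] assms by (simp add: insert_absorb)

text \<open>A subset with k + 1 elements arises once for each choice of its marked element
  a.\<close>

lemma sum_marked_esym:
  assumes "finite A"
  shows "(\<Sum>a\<in>A. t a * esym (A - {a}) t k) = of_nat (Suc k) * esym A t (Suc k)"
  using assms
proof (induction A arbitrary: k rule: finite_induct)
  case empty
  then show ?case by (simp add: esym_eq_0)
next
  case (insert b A)
  have d: "insert b A - {a} = insert b (A - {a})" if "a \<in> A" for a
    using that insert.hyps by auto
  have "(\<Sum>a\<in>insert b A. t a * esym (insert b A - {a}) t k) =
      t b * esym A t k + (\<Sum>a\<in>A. t a * esym (insert b (A - {a})) t k)"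
    using insert.hyps d by simp
  also have "(\<Sum>a\<in>A. t a * esym (insert b (A - {a})) t k) =
      of_nat (Suc k) * esym A t (Suc k) + t b * (of_nat k * esym A t k)"
  proof (cases k)
    case 0
    then show ?thesis using insert.IH[of 0] insert.hyps by simp
  next
    case (Suc j)
    have "(\<Sum>a\<in>A. t a * esym (insert b (A - {a})) t k) =
        (\<Sum>a\<in>A. t a * esym (A - {a}) t k) + t b * (\<Sum>a\<in>A. t a * esym (A - {a}) t j)"
      unfolding Suc sum_distrib_left sum.distrib[symmetric]
      using insert.hyps by (intro sum.cong refl) (simp add: esym_insert algebra_simps)
    then show ?thesis by (simp only: insert.IH Suc)
  qed
  finally show ?case using insert.hyps by (simp add: esym_insert algebra_simps)
qed

text \<open>With e_k taken over A - {x}, eliminating t(x) from the two instances of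
  \<open>esym_remove\<close> gives e_a e_{b+1} = e_{a+1} e_b + (E_{b+1} e_a - E_{a+1} e_b).
  Repeating this until the second index is 0 leaves at most one factor that omits x in each term.
  All negative signs that the cone must absorb come from here.\<close>

lemma esym_marked_prod:
  assumes "finite A" "x \<in> A"
  shows "esym (A - {x}) t a * esym (A - {x}) t b = esym (A - {x}) t (a + b) +
    (\<Sum>l=1..b. esym A t l * esym (A - {x}) t (a + b - l)
      - esym A t (a + b + 1 - l) * esym (A - {x}) t (l - 1))"
proof (induction b arbitrary: a)
  case 0
  then show ?case using assms by simp
next
  case (Suc b)
  have "esym (A - {x}) t a * esym (A - {x}) t (Suc b) =
      esym (A - {x}) t (Suc a) * esym (A - {x}) t b
      + (esym A t (Suc b) * esym (A - {x}) t a - esym A t (Suc a) * esym (A - {x}) t b)"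
    by (simp add: esym_remove[OF assms] algebra_simps)
  then show ?case
    unfolding Suc.IH[of "Suc a"] by (simp add: sum.nat_ivl_Suc')
qed

section \<open>A cone that is stable under appending a letter\<close>

text \<open>The pair reached from (i, 0) after j steps (a, b) \<mapsto> (b, a + 1).\<close>

definition pair_fst :: "nat \<Rightarrow> nat \<Rightarrow> nat" where
  "pair_fst i j = (if even j then i + j div 2 else j div 2)"

definition pair_snd :: "nat \<Rightarrow> nat \<Rightarrow> nat" where
  "pair_snd i j = (if even j then j div 2 else i + j div 2 + 1)"

lemma pair_0 [simp]: "pair_fst i 0 = i" "pair_snd i 0 = 0"
  by (simp_all add: pair_fst_def pair_snd_def)

lemma pair_Suc [simp]:
  "pair_fst i (Suc j) = pair_snd i j" "pair_snd i (Suc j) = Suc (pair_fst i j)"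
  by (auto simp: pair_fst_def pair_snd_def elim!: evenE oddE)

lemma pair_add: "pair_fst i j + pair_snd i j = i + j"
  by (auto simp: pair_fst_def pair_snd_def elim!: evenE oddE)

text \<open>For either parity of j the indices a + 1 and b are, in some order, m and i + j + 1 - m.
  Hence the product of e_{a+1} and e_b depends only on m and i + j, and both parities can be
  expanded at once.\<close>

lemma pair_cases:
  fixes i j :: nat
  defines "m \<equiv> (j + 1) div 2"
  shows "pair_snd i j = m \<and> pair_fst i j + m = i + j \<or> Suc (pair_fst i j) = m \<and> pair_snd i j + m = Suc (i + j)"
  by (auto simp: pair_fst_def pair_snd_def m_def elim!: evenE oddE)

text \<open>Equality is allowed because a chain is prolonged by exactly the sum of its terms. The
  indices start at 1; the missing start 0 is taken over by \<open>joint\<close> in the cone.\<close>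

definition superincreasing :: "nat \<Rightarrow> (nat \<Rightarrow> real) \<Rightarrow> bool" where
  "superincreasing N M \<longleftrightarrow> (\<forall>i\<in>{1..N}. 0 \<le> M i \<and> (\<Sum>j=1..<i. M j) \<le> M i)"

text \<open>The coefficient of e_{N+1-k} e_k(A - {x}) that the function started at i produces when a
  letter is appended; the first summand is the positive one that pays for the last one.\<close>

definition step_coeff :: "nat \<Rightarrow> nat \<Rightarrow> nat \<Rightarrow> real" where
  "step_coeff N i k =
    (if k = pair_snd i (N - i) then real (pair_fst i (N - i)) - 1 else 0)
    + (if N + 1 \<le> k + (N - i + 1) div 2 then 1 else 0)
    - (if k < (N - i + 1) div 2 then 1 else 0)"

text \<open>The bound on N says that k is at least half of N - i, so the last indicator vanishes.
  The first summand is negative only for a = 0 and k = b; it is then -1 and is offset by the second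
  indicator.\<close>

lemma step_coeff_nonneg:
  assumes "1 \<le> i" "i \<le> N" "k \<le> N" "N \<le> i + 2 * k"
  shows "0 \<le> step_coeff N i k"
proof -
  define m where "m = (N - i + 1) div 2"
  have "\<not> k < m" unfolding m_def using assms by presburger
  moreover have "N + 1 \<le> k + m" if "k = pair_snd i (N - i)" "pair_fst i (N - i) = 0"
    using pair_cases[of i "N - i"] that assms unfolding m_def[symmetric] by auto
  ultimately show ?thesis
    unfolding step_coeff_def m_def[symmetric]
    by (cases "pair_fst i (N - i)") auto
qed

lemma sum_step_coeff_nonneg:
  assumes M: "superincreasing N M" and k: "k \<le> N"
  shows "0 \<le> (\<Sum>i=1..N. M i * step_coeff N i k)"
proof (cases "N \<le> 2 * k")
  case True
  then show ?thesis
    using M k by (intro sum_nonneg mult_nonneg_nonneg step_coeff_nonneg) (auto simp: superincreasing_def)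
next
  case False
  \<comment> \<open>The function started at r has made 2k steps, so its pair is (N - k, k) and it
    meets e_k with first summand N - k - 1. Functions started later than r have no negative term at
    this k; those started earlier have coefficient at least -1.\<close>
  define r where "r = N - 2 * k"
  have r: "1 \<le> r" "r \<le> N" "N - r = 2 * k" using False by (auto simp: r_def)
  have M0: "0 \<le> M i" if "i \<in> {1..N}" for i
    using M that by (auto simp: superincreasing_def)
  have low: "- M i \<le> M i * step_coeff N i k" if "i \<in> {1..<r}" for i
  proof -
    \<comment> \<open>The first summand cannot be negative here: a = 0 and b = k would give N = k,
      against 2k < N.\<close>
    have "pair_fst i (N - i) \<noteq> 0 \<or> pair_snd i (N - i) \<noteq> k"
      using pair_add[of i "N - i"] that False by (auto simp: r_def)
    then have "-1 \<le> step_coeff N i k"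
      unfolding step_coeff_def by (cases "pair_fst i (N - i)") auto
    then show ?thesis
      using M0[of i] that r mult_left_mono[of "-1" "step_coeff N i k" "M i"] by auto
  qed
  have mid: "(\<Sum>i=1..<r. M i) \<le> M r * step_coeff N r k"
  proof -
    have pr: "pair_fst r (N - r) = N - k" "pair_snd r (N - r) = k"
      using r k by (auto simp: pair_fst_def pair_snd_def r_def)
    have c: "step_coeff N r k = real (N - k) - 1"
      unfolding step_coeff_def pr using r k by auto
    show ?thesis
    \<comment> \<open>For r = 1 there is no earlier function to pay for, and N - k - 1 = k may be 0.
      For r > 1 it is at least 1.\<close>
    proof (cases "r = 1")
      case True
      then show ?thesis using M0[of r] r k False unfolding c by (auto simp: of_nat_diff)
    next
      case False
      then have "1 \<le> step_coeff N r k" unfolding c using r k by (simp add: r_def)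
      then have "M r \<le> M r * step_coeff N r k"
        using mult_left_mono[of 1 "step_coeff N r k" "M r"] M0[of r] r by auto
      moreover have "(\<Sum>i=1..<r. M i) \<le> M r"
        using M r by (auto simp: superincreasing_def)
      ultimately show ?thesis by linarith
    qed
  qed
  have high: "0 \<le> M i * step_coeff N i k" if "i \<in> {r<..N}" for i
    using that k M0[of i] by (intro mult_nonneg_nonneg step_coeff_nonneg) (auto simp: r_def)
  have "{1..N} = {1..<r} \<union> ({r} \<union> {r<..N})" using r by auto
  then have "(\<Sum>i=1..N. M i * step_coeff N i k) = (\<Sum>i=1..<r. M i * step_coeff N i k)
      + (M r * step_coeff N r k + (\<Sum>i\<in>{r<..N}. M i * step_coeff N i k))"
    by (simp only:) (subst sum.union_disjoint, auto)+
  moreover have "(\<Sum>i=1..<r. - M i) \<le> (\<Sum>i=1..<r. M i * step_coeff N i k)"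
    using low by (rule sum_mono)
  moreover have "0 \<le> (\<Sum>i\<in>{r<..N}. M i * step_coeff N i k)"
    using high by (rule sum_nonneg)
  ultimately show ?thesis using mid by (simp add: sum_negf)
qed

section \<open>Cones of functions with one or two marked letters, and the operations on them\<close>

locale finite_alphabet =
  fixes A :: "nat set"
  assumes finite_A: "finite A"
begin

abbreviation E :: "(nat \<Rightarrow> complex) \<Rightarrow> nat \<Rightarrow> complex" where
  "E t k \<equiv> esym A t k"

abbreviation eps :: "(nat \<Rightarrow> complex) \<Rightarrow> nat \<Rightarrow> nat \<Rightarrow> complex" where
  "eps t x k \<equiv> esym (A - {x}) t k"

text \<open>The index is the degree without the marked letter x. Agreement is required only at
  letters of A, since identities such as \<open>eps_Suc\<close> hold only there.\<close>

inductive spos :: "nat \<Rightarrow> ((nat \<Rightarrow> complex) \<Rightarrow> nat \<Rightarrow> complex) \<Rightarrow> bool" where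
  gen: "spos k (\<lambda>t x. t x * eps t x k)"
| zero: "spos n (\<lambda>t x. 0)"
| add: "spos n f \<Longrightarrow> spos n g \<Longrightarrow> spos n (\<lambda>t x. f t x + g t x)"
| scale: "spos n f \<Longrightarrow> 0 \<le> c \<Longrightarrow> spos n (\<lambda>t x. of_real c * f t x)"
| mult: "spos n f \<Longrightarrow> 1 \<le> l \<Longrightarrow> spos (n + l) (\<lambda>t x. E t l * f t x)"
| ext: "spos n f \<Longrightarrow> (\<And>t x. x \<in> A \<Longrightarrow> f t x = g t x) \<Longrightarrow> spos n g"

definition pair_fun :: "nat \<Rightarrow> nat \<Rightarrow> (nat \<Rightarrow> complex) \<Rightarrow> nat \<Rightarrow> nat \<Rightarrow> complex" where
  "pair_fun a b t y x = t y * eps t y a * (t x * eps t x b)"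

definition chain :: "nat \<Rightarrow> (nat \<Rightarrow> real) \<Rightarrow> (nat \<Rightarrow> complex) \<Rightarrow> nat \<Rightarrow> nat \<Rightarrow> complex" where
  "chain N M t y x =
    (\<Sum>i=1..N. of_real (M i) * pair_fun (pair_fst i (N - i)) (pair_snd i (N - i)) t y x)"

text \<open>The index is the degree without the two marked letters. Pairs with x = y are ignored
  because adjacent letters of a proper word differ.\<close>

inductive cone :: "nat \<Rightarrow> ((nat \<Rightarrow> complex) \<Rightarrow> nat \<Rightarrow> nat \<Rightarrow> complex) \<Rightarrow> bool" where
  joint: "cone k (\<lambda>t y x. t y * t x * esym (A - {x, y}) t k)"
| chain: "superincreasing N M \<Longrightarrow> cone N (chain N M)"
| zero: "cone n (\<lambda>t y x. 0)"
| add: "cone n f \<Longrightarrow> cone n g \<Longrightarrow> cone n (\<lambda>t y x. f t y x + g t y x)"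
| scale: "cone n f \<Longrightarrow> 0 \<le> c \<Longrightarrow> cone n (\<lambda>t y x. of_real c * f t y x)"
| mult: "cone n f \<Longrightarrow> 1 \<le> l \<Longrightarrow> cone (n + l) (\<lambda>t y x. E t l * f t y x)"
| ext: "cone n f \<Longrightarrow> (\<And>t x y. x \<in> A \<Longrightarrow> y \<in> A \<Longrightarrow> x \<noteq> y \<Longrightarrow> f t y x = g t y x) \<Longrightarrow> cone n g"

lemma spos_sum:
  assumes "finite I" "\<And>i. i \<in> I \<Longrightarrow> spos n (f i)"
  shows "spos n (\<lambda>t x. \<Sum>i\<in>I. f i t x)"
  using assms by (induction I rule: finite_induct) (auto intro: spos.zero spos.add)

definition unmark_fst ::
    "((nat \<Rightarrow> complex) \<Rightarrow> nat \<Rightarrow> nat \<Rightarrow> complex) \<Rightarrow> (nat \<Rightarrow> complex) \<Rightarrow> nat \<Rightarrow> complex" where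
  "unmark_fst g t x = (\<Sum>y\<in>A - {x}. g t y x)"

text \<open>In the triangular ladder three consecutive letters a, y, x are distinct; a different
  from y is built into the words counted by g, up to the value at a = y, which is left out
  here.\<close>

definition append_letter ::
    "((nat \<Rightarrow> complex) \<Rightarrow> nat \<Rightarrow> nat \<Rightarrow> complex) \<Rightarrow> (nat \<Rightarrow> complex) \<Rightarrow> nat \<Rightarrow> nat \<Rightarrow> complex" where
  "append_letter g t y x = t x * (\<Sum>a\<in>A - {x, y}. g t a y)"

lemma append_letter_eq:
  assumes "x \<in> A" "x \<noteq> y"
  shows "append_letter g t y x = t x * unmark_fst g t y - t x * g t x y"
proof -
  have "unmark_fst g t y = g t x y + (\<Sum>a\<in>A - {y} - {x}. g t a y)"
    unfolding unmark_fst_def by (rule sum.remove) (use assms finite_A in auto)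
  moreover have "A - {y} - {x} = A - {x, y}" by auto
  ultimately show ?thesis unfolding append_letter_def by (simp only:) (simp add: algebra_simps)
qed

lemma eps_Suc:
  assumes "x \<in> A"
  shows "t x * eps t x k = E t (Suc k) - eps t x (Suc k)"
  using esym_remove[OF finite_A assms, of t k] by simp

lemma sum_eps_other:
  assumes "x \<in> A"
  shows "(\<Sum>y\<in>A - {x}. t y * eps t y a) = of_nat a * E t (Suc a) + eps t x (Suc a)"
proof -
  have "(\<Sum>y\<in>A. t y * eps t y a) = t x * eps t x a + (\<Sum>y\<in>A - {x}. t y * eps t y a)"
    using finite_A assms by (rule sum.remove)
  then have "(\<Sum>y\<in>A - {x}. t y * eps t y a) = of_nat (Suc a) * E t (Suc a) - t x * eps t x a"
    unfolding sum_marked_esym[OF finite_A] by simp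
  then show ?thesis unfolding eps_Suc[OF assms] by (simp add: algebra_simps)
qed

lemma unmark_pair_fun:
  assumes "x \<in> A"
  shows "unmark_fst (pair_fun a b) t x =
    t x * (of_nat a * E t (Suc a) * eps t x b + eps t x (Suc a) * eps t x b)"
  unfolding unmark_fst_def pair_fun_def sum_distrib_right[symmetric] sum_eps_other[OF assms]
  by (simp add: algebra_simps)

text \<open>One copy of E_{a+1} e_b is kept apart, which is why \<open>step_coeff\<close> contains a
  - 1 instead of a: this copy is what cancels when a letter is appended. The term e_{N+1} is kept
  apart because it starts a new function B.\<close>

lemma eps_prod_step:
  assumes "x \<in> A" "1 \<le> i" "i \<le> N"
  defines "a \<equiv> pair_fst i (N - i)" and "b \<equiv> pair_snd i (N - i)"
  shows "of_nat a * E t (Suc a) * eps t x b + eps t x (Suc a) * eps t x b =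
    E t (Suc a) * eps t x b + eps t x (Suc N)
    + (\<Sum>k\<le>N. of_real (step_coeff N i k) * (E t (N + 1 - k) * eps t x k))"
proof -
  define m where "m = (N - i + 1) div 2"
  have ab: "a + b = N" unfolding a_def b_def pair_add using assms(2,3) by simp
  have m: "(b = m \<and> Suc a = N + 1 - m) \<or> (Suc a = m \<and> b = N + 1 - m)"
    using pair_cases[of i "N - i"] assms(2,3) unfolding a_def b_def m_def[symmetric] by auto
  have mN: "m \<le> N" unfolding m_def using assms(2,3) by auto
  let ?X = "\<lambda>k. E t (N + 1 - k) * eps t x k"
  \<comment> \<open>The smaller index m is placed second, so the expansion is as short as possible
    and its negative terms occur only for k < m.\<close>
  have "eps t x (Suc a) * eps t x b = eps t x (N + 1 - m) * eps t x m"
    using m by auto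
  also have "\<dots> = eps t x (Suc N) + (\<Sum>l=1..m. E t l * eps t x (N + 1 - l)
      - E t (N + 2 - l) * eps t x (l - 1))"
    using esym_marked_prod[OF finite_A assms(1), of t "N + 1 - m" m] mN by simp
  also have "(\<Sum>l=1..m. E t l * eps t x (N + 1 - l) - E t (N + 2 - l) * eps t x (l - 1)) =
      (\<Sum>l=1..m. ?X (N + 1 - l)) - (\<Sum>l=1..m. ?X (l - 1))"
    unfolding sum_subtractf[symmetric] using mN by (intro sum.cong refl) (auto simp: Suc_diff_le)
  also have "(\<Sum>l=1..m. ?X (N + 1 - l)) = (\<Sum>k\<in>{N + 1 - m..N}. ?X k)"
    by (rule sum.reindex_bij_witness[of _ "\<lambda>k. N + 1 - k" "\<lambda>k. N + 1 - k"]) (use mN in auto)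
  also have "\<dots> = (\<Sum>k\<le>N. (if N + 1 \<le> k + m then ?X k else 0))"
    by (subst sum.inter_filter[symmetric]) (auto intro!: sum.cong)
  also have "(\<Sum>l=1..m. ?X (l - 1)) = (\<Sum>k<m. ?X k)"
    by (rule sum.reindex_bij_witness[of _ Suc "\<lambda>k. k - 1"]) auto
  also have "\<dots> = (\<Sum>k\<le>N. (if k < m then ?X k else 0))"
    using mN by (subst sum.inter_filter[symmetric]) (auto intro!: sum.cong)
  finally have 1: "eps t x (Suc a) * eps t x b = eps t x (Suc N) +
    ((\<Sum>k\<le>N. (if N + 1 \<le> k + m then ?X k else 0)) - (\<Sum>k\<le>N. (if k < m then ?X k else 0)))" .
  have "(\<Sum>k\<le>N. of_real (step_coeff N i k) * ?X k) =
     (\<Sum>k\<le>N. (if k = b then (of_nat a - 1) * ?X k else 0)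
        + ((if N + 1 \<le> k + m then ?X k else 0) - (if k < m then ?X k else 0)))"
    unfolding step_coeff_def m_def[symmetric] a_def[symmetric] b_def[symmetric]
    by (intro sum.cong refl) (simp add: algebra_simps)
  also have "\<dots> = (of_nat a - 1) * ?X b +
      ((\<Sum>k\<le>N. (if N + 1 \<le> k + m then ?X k else 0)) - (\<Sum>k\<le>N. (if k < m then ?X k else 0)))"
    unfolding sum.distrib sum_subtractf using ab by simp
  also have "?X b = E t (Suc a) * eps t x b" using ab by auto
  finally show ?thesis unfolding 1 by (simp add: algebra_simps)
qed

definition surplus :: "nat \<Rightarrow> (nat \<Rightarrow> real) \<Rightarrow> (nat \<Rightarrow> complex) \<Rightarrow> nat \<Rightarrow> complex" where
  "surplus N M t x =
    (\<Sum>k\<le>N. of_real (\<Sum>i=1..N. M i * step_coeff N i k) * (E t (N + 1 - k) * (t x * eps t x k)))"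

lemma spos_surplus:
  assumes "superincreasing N M"
  shows "spos (Suc N) (surplus N M)"
  unfolding surplus_def
proof (intro spos_sum spos.scale sum_step_coeff_nonneg assms)
  fix k assume "k \<in> {..N}"
  then show "spos (Suc N) (\<lambda>t x. E t (N + 1 - k) * (t x * eps t x k))"
    using spos.mult[OF spos.gen[of k], of "N + 1 - k"] by auto
qed auto

text \<open>The three summands fare differently when a letter is appended: the first is cancelled by
  the excluded words, the second becomes the function started at N + 1, and the third has
  nonnegative coefficients and is simply lifted.\<close>

lemma unmark_chain:
  assumes "x \<in> A"
  shows "unmark_fst (chain N M) t x =
    (\<Sum>i=1..N. of_real (M i) * (E t (Suc (pair_fst i (N - i))) * (t x * eps t x (pair_snd i (N - i)))))
    + of_real (\<Sum>i=1..N. M i) * (t x * eps t x (Suc N)) + surplus N M t x"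
proof -
  have "unmark_fst (chain N M) t x =
      (\<Sum>i=1..N. of_real (M i) * unmark_fst (pair_fun (pair_fst i (N - i)) (pair_snd i (N - i))) t x)"
    unfolding unmark_fst_def chain_def by (subst sum.swap) (simp add: sum_distrib_left)
  also have "\<dots> = (\<Sum>i=1..N. of_real (M i) *
      (E t (Suc (pair_fst i (N - i))) * (t x * eps t x (pair_snd i (N - i))))
      + of_real (M i) * (t x * eps t x (Suc N))
      + (\<Sum>k\<le>N. of_real (M i * step_coeff N i k) * (E t (N + 1 - k) * (t x * eps t x k))))"
  proof (intro sum.cong refl)
    fix i assume "i \<in> {1..N}"
    then have i: "1 \<le> i" "i \<le> N" by auto
    show "of_real (M i) * unmark_fst (pair_fun (pair_fst i (N - i)) (pair_snd i (N - i))) t x =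
      of_real (M i) * (E t (Suc (pair_fst i (N - i))) * (t x * eps t x (pair_snd i (N - i))))
      + of_real (M i) * (t x * eps t x (Suc N))
      + (\<Sum>k\<le>N. of_real (M i * step_coeff N i k) * (E t (N + 1 - k) * (t x * eps t x k)))"
      unfolding unmark_pair_fun[OF assms] eps_prod_step[OF assms i]
      by (simp add: distrib_left sum_distrib_left ac_simps)
  qed
  also have "\<dots> = (\<Sum>i=1..N. of_real (M i) *
      (E t (Suc (pair_fst i (N - i))) * (t x * eps t x (pair_snd i (N - i)))))
      + of_real (\<Sum>i=1..N. M i) * (t x * eps t x (Suc N)) + surplus N M t x"
  proof -
    have "(\<Sum>i=1..N. \<Sum>k\<le>N. of_real (M i * step_coeff N i k) * (E t (N + 1 - k) * (t x * eps t x k)))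
        = surplus N M t x"
      unfolding surplus_def of_real_sum sum_distrib_right by (rule sum.swap)
    then show ?thesis by (simp only: sum.distrib of_real_sum sum_distrib_right)
  qed
  finally show ?thesis .
qed

text \<open>A generator with k > 0 lifts to B(k, 0), a function that has just been started, that is,
  a chain with the single weight 1 at i = k = N.\<close>

lemma spos_lift:
  assumes "spos n f"
  shows "cone n (\<lambda>t y x. t x * f t y)"
  using assms
proof (induction rule: spos.induct)
  case (gen k)
  show ?case
  proof (cases "k = 0")
    \<comment> \<open>Chains have no start 0, but t(y) t(x) is also the \<open>joint\<close>
      function with k = 0.\<close>
    case True
    show ?thesis unfolding True
      by (rule cone.ext[OF cone.joint[of 0]]) (simp add: finite_A)
  next
    case False
    define M where "M i = (if i = k then 1 else 0 :: real)" for i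
    have "superincreasing k M"
      by (auto simp: superincreasing_def M_def)
    then have "cone k (chain k M)" by (rule cone.chain)
    then show ?thesis
    proof (rule cone.ext)
      fix t x y
      have "chain k M t y x = (\<Sum>i=1..k. if i = k then pair_fun k 0 t y x else 0)"
        unfolding chain_def by (intro sum.cong) (auto simp: M_def)
      then show "chain k M t y x = t x * (t y * eps t y k)"
        using False finite_A by (simp add: pair_fun_def)
    qed
  qed
next
  case (zero n)
  show ?case using cone.zero by simp
next
  case (add n f g)
  show ?case by (rule cone.ext[OF cone.add[OF add.IH]]) (simp add: algebra_simps)
next
  case (scale n f c)
  show ?case by (rule cone.ext[OF cone.scale[OF scale.IH scale.hyps(2)]]) simp
next
  case (mult n f l)
  show ?case by (rule cone.ext[OF cone.mult[OF mult.IH mult.hyps(2)]]) simp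
next
  case (ext n f g)
  show ?case by (rule cone.ext[OF ext.IH]) (simp add: ext.hyps)
qed

lemma unmark_joint:
  assumes "x \<in> A"
  shows "unmark_fst (\<lambda>t y x. t y * t x * esym (A - {x, y}) t k) t x
    = of_nat (Suc k) * (t x * eps t x (Suc k))"
proof -
  have "A - {x, y} = A - {x} - {y}" for y by auto
  then have "unmark_fst (\<lambda>t y x. t y * t x * esym (A - {x, y}) t k) t x =
      t x * (\<Sum>y\<in>A - {x}. t y * esym (A - {x} - {y}) t k)"
    unfolding unmark_fst_def sum_distrib_left by (intro sum.cong refl) (simp only: ac_simps)
  then show ?thesis by (simp add: sum_marked_esym finite_A)
qed

theorem cone_unmark_fst:
  assumes "cone n g"
  shows "spos (Suc n) (unmark_fst g)"
  using assms
proof (induction rule: cone.induct)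
  case (joint k)
  show ?case
    by (rule spos.ext[OF spos.scale[OF spos.gen[of "Suc k"], of "real (Suc k)"]])
      (simp_all only: unmark_joint of_real_of_nat_eq of_nat_0_le_iff)
next
  case (chain N M)
  have M: "0 \<le> M i" if "i \<in> {1..N}" for i
    using chain that by (auto simp: superincreasing_def)
  have 1: "spos (Suc N) (\<lambda>t x. E t (Suc (pair_fst i (N - i))) * (t x * eps t x (pair_snd i (N - i))))"
    if "i \<in> {1..N}" for i
  proof -
    have "pair_snd i (N - i) + Suc (pair_fst i (N - i)) = Suc N"
      using pair_add[of i "N - i"] that by auto
    then show ?thesis
      using spos.mult[OF spos.gen[of "pair_snd i (N - i)"], of "Suc (pair_fst i (N - i))"] by simp
  qed
  show ?case
    by (rule spos.ext[OF spos.add[OF spos.add[OF spos_sum[OF _ spos.scale[OF 1 M]]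
            spos.scale[OF spos.gen sum_nonneg[OF M]]] spos_surplus[OF chain]]])
      (auto simp: unmark_chain)
next
  case (zero n)
  show ?case by (rule spos.ext[OF spos.zero]) (simp add: unmark_fst_def)
next
  case (add n f g)
  show ?case by (rule spos.ext[OF spos.add[OF add.IH]]) (simp add: unmark_fst_def sum.distrib)
next
  case (scale n f c)
  show ?case
    by (rule spos.ext[OF spos.scale[OF scale.IH scale.hyps(2)]]) (simp add: unmark_fst_def sum_distrib_left)
next
  case (mult n f l)
  show ?case
    by (rule spos.ext[of "Suc n + l", simplified, OF spos.mult[OF mult.IH mult.hyps(2), simplified]])
      (simp add: unmark_fst_def sum_distrib_left)
next
  case (ext n f g)
  show ?case
    by (rule spos.ext[OF ext.IH]) (auto simp: unmark_fst_def intro!: sum.cong ext.hyps)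
qed

text \<open>Summing over all a gives k + 1 copies of t(x) t(y) e_{k+1}(A - {y}). Splitting one copy
  according to whether x is used, the part using x is exactly the subtracted term; the other k
  copies survive.\<close>

lemma append_joint:
  assumes "x \<in> A" "y \<in> A" "x \<noteq> y"
  shows "append_letter (\<lambda>t y x. t y * t x * esym (A - {x, y}) t k) t y x =
    t y * t x * esym (A - {x, y}) t (Suc k) + of_nat k * (t x * (t y * eps t y (Suc k)))"
proof -
  have *: "eps t y (Suc k) = esym (A - {x, y}) t (Suc k) + t x * esym (A - {x, y}) t k"
    using esym_remove[of "A - {y}" x t k] assms finite_A
    by (simp add: Diff_insert2[symmetric] insert_commute)
  show ?thesis
    unfolding append_letter_eq[OF assms(1,3)] unmark_joint[OF assms(2)]
    by (simp add: * insert_commute algebra_simps)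
qed

lemma append_chain:
  assumes "x \<in> A" "y \<in> A" "x \<noteq> y"
  shows "append_letter (chain N M) t y x =
    chain (Suc N) (M(Suc N := \<Sum>i=1..N. M i)) t y x + t x * surplus N M t y"
proof -
  let ?a = "\<lambda>i. pair_fst i (N - i)" and ?b = "\<lambda>i. pair_snd i (N - i)"
  \<comment> \<open>The excluded words, rewritten by \<open>eps_Suc\<close>: the evolved pairs
    appear with a minus sign and thus enter the difference with a plus sign.\<close>
  have 1: "t x * chain N M t x y = (\<Sum>i=1..N. of_real (M i) * (t x * (E t (Suc (?a i)) * (t y * eps t y (?b i))))) -
      (\<Sum>i=1..N. of_real (M i) * pair_fun (?b i) (Suc (?a i)) t y x)"
    unfolding chain_def sum_distrib_left sum_subtractf[symmetric]
  proof (intro sum.cong refl)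
    fix i
    have "pair_fun (?a i) (?b i) t x y = (E t (Suc (?a i)) - eps t x (Suc (?a i))) * (t y * eps t y (?b i))"
      unfolding pair_fun_def eps_Suc[OF assms(1)] ..
    then show "t x * (of_real (M i) * pair_fun (?a i) (?b i) t x y) =
        of_real (M i) * (t x * (E t (Suc (?a i)) * (t y * eps t y (?b i)))) -
        of_real (M i) * pair_fun (?b i) (Suc (?a i)) t y x"
      by (simp only:) (simp add: pair_fun_def algebra_simps)
  qed
  \<comment> \<open>All old functions advance by one step, and the new index \<open>Suc N\<close>
    starts at (N + 1, 0) with the sum of the old weights.\<close>
  have "chain (Suc N) (M(Suc N := \<Sum>i=1..N. M i)) t y x =
      (\<Sum>i=1..N. of_real (M i) * pair_fun (?b i) (Suc (?a i)) t y x) +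
      of_real (\<Sum>i=1..N. M i) * pair_fun (Suc N) 0 t y x"
    unfolding chain_def by (simp add: Suc_diff_le)
  then show ?thesis
    unfolding append_letter_eq[OF assms(1,3)] unmark_chain[OF assms(2)] 1
    by (simp add: algebra_simps sum_distrib_left pair_fun_def finite_A)
qed

theorem cone_append_letter:
  assumes "cone n g"
  shows "cone (Suc n) (append_letter g)"
  using assms
proof (induction rule: cone.induct)
  case (joint k)
  show ?case
    by (rule cone.ext[OF cone.add[OF cone.joint[of "Suc k"]
            cone.scale[OF spos_lift[OF spos.gen[of "Suc k"]], of "real k"]]])
      (simp_all add: append_joint)
next
  case (chain N M)
  let ?M = "M(Suc N := \<Sum>i=1..N. M i)"
  have "superincreasing (Suc N) ?M"
    using chain unfolding superincreasing_def
    by (auto simp: le_Suc_eq atLeastLessThanSuc_atLeastAtMost intro!: sum_nonneg)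
  then show ?case
    by (rule cone.ext[OF cone.add[OF cone.chain spos_lift[OF spos_surplus[OF chain]]]])
      (simp add: append_chain)
next
  case (zero n)
  show ?case by (rule cone.ext[OF cone.zero]) (simp add: append_letter_def)
next
  case (add n f g)
  show ?case
    by (rule cone.ext[OF cone.add[OF add.IH]]) (simp add: append_letter_def sum.distrib algebra_simps)
next
  case (scale n f c)
  show ?case
    by (rule cone.ext[OF cone.scale[OF scale.IH scale.hyps(2)]])
      (simp add: append_letter_def sum_distrib_left ac_simps)
next
  case (mult n f l)
  show ?case
    by (rule cone.ext[of "Suc n + l", simplified, OF cone.mult[OF mult.IH mult.hyps(2), simplified]])
      (simp add: append_letter_def sum_distrib_left ac_simps)
next
  case (ext n f g)
  show ?case
    by (rule cone.ext[OF ext.IH]) (auto simp: append_letter_def intro!: sum.cong ext.hyps)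
qed

end

section \<open>Expansion into marked basis functions indexed by types\<close>

definition types :: "nat \<Rightarrow> (nat multiset \<times> nat) set" where
  "types n = {(L, b). 0 < b \<and> 0 \<notin># L \<and> sum_mset L + b = n}"

lemma size_le_sum_mset:
  assumes "0 \<notin># (L :: nat multiset)"
  shows "size L \<le> sum_mset L"
  using assms by (induction L) (auto simp: Suc_le_eq)

lemma finite_types: "finite (types n)"
proof -
  have "types n \<subseteq> (mset ` {xs. set xs \<subseteq> {..n} \<and> length xs \<le> n}) \<times> {..n}"
  proof safe
    fix L b assume *: "(L, b) \<in> types n"
    obtain xs where xs: "L = mset xs" by (metis ex_mset)
    have "size L \<le> n" using size_le_sum_mset[of L] * by (auto simp: types_def)
    moreover have "set xs \<subseteq> {..n}"
      using * member_le_sum_list[of _ xs] by (fastforce simp: types_def xs sum_mset_sum_list)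
    ultimately show "L \<in> mset ` {xs. set xs \<subseteq> {..n} \<and> length xs \<le> n}"
      unfolding xs by (intro imageI) auto
  qed (auto simp: types_def)
  then show ?thesis
    by (rule finite_subset) (intro finite_cartesian_product finite_imageI finite_lists_length_le; simp)
qed

definition marked_basis :: "nat set \<Rightarrow> (nat \<Rightarrow> 'a::comm_ring_1) \<Rightarrow> nat \<Rightarrow> nat multiset \<times> nat \<Rightarrow> 'a" where
  "marked_basis A t x \<theta> =
    (\<Prod>l\<in>#fst \<theta>. esym A t l) * (t x * esym (A - {x}) t (snd \<theta> - 1))"

text \<open>The point is the order of the quantifiers: one nonnegative family C serves all weights t
  and all letters x.\<close>

lemma (in finite_alphabet) spos_coeffs:
  assumes "spos n f"
  shows "\<exists>C. (\<forall>\<theta>. 0 \<le> C \<theta>) \<and>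
    (\<forall>t. \<forall>x\<in>A. f t x = (\<Sum>\<theta>\<in>types (Suc n). of_real (C \<theta>) * marked_basis A t x \<theta>))"
  using assms
proof (induction rule: spos.induct)
  case (gen k)
  let ?C = "\<lambda>\<theta>. if \<theta> = ({#}, Suc k) then 1 else 0 :: real"
  have "({#}, Suc k) \<in> types (Suc k)" by (simp add: types_def)
  then have "t x * eps t x k =
      (\<Sum>\<theta>\<in>types (Suc k). if \<theta> = ({#}, Suc k) then marked_basis A t x \<theta> else 0)" for t x
    by (simp add: finite_types marked_basis_def)
  also have "\<dots> t x = (\<Sum>\<theta>\<in>types (Suc k). of_real (?C \<theta>) * marked_basis A t x \<theta>)" for t x
    by (intro sum.cong) auto
  finally show ?case by (intro exI[of _ ?C]) auto
next
  case (zero n)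
  show ?case by (rule exI[of _ "\<lambda>_. 0"]) simp
next
  case (add n f g)
  from add.IH(1) obtain C where C: "\<forall>\<theta>. 0 \<le> C \<theta>"
    "\<And>t x. x \<in> A \<Longrightarrow> f t x = (\<Sum>\<theta>\<in>types (Suc n). of_real (C \<theta>) * marked_basis A t x \<theta>)"
    by blast
  from add.IH(2) obtain D where D: "\<forall>\<theta>. 0 \<le> D \<theta>"
    "\<And>t x. x \<in> A \<Longrightarrow> g t x = (\<Sum>\<theta>\<in>types (Suc n). of_real (D \<theta>) * marked_basis A t x \<theta>)"
    by blast
  show ?case
    by (rule exI[of _ "\<lambda>\<theta>. C \<theta> + D \<theta>"]) (use C D in \<open>auto simp: distrib_right sum.distrib\<close>)
next
  case (scale n f c)
  then obtain C where C: "\<forall>\<theta>. 0 \<le> C \<theta>"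
    "\<And>t x. x \<in> A \<Longrightarrow> f t x = (\<Sum>\<theta>\<in>types (Suc n). of_real (C \<theta>) * marked_basis A t x \<theta>)"
    by blast
  show ?case
    by (rule exI[of _ "\<lambda>\<theta>. c * C \<theta>"])
      (use C scale.hyps in \<open>auto simp: sum_distrib_left mult.assoc\<close>)
next
  case (mult n f l)
  then obtain C where C: "\<forall>\<theta>. 0 \<le> C \<theta>"
    "\<And>t x. x \<in> A \<Longrightarrow> f t x = (\<Sum>\<theta>\<in>types (Suc n). of_real (C \<theta>) * marked_basis A t x \<theta>)"
    by blast
  \<comment> \<open>Multiplication by E_l adjoins a part l; types without such a part are not
    reached and get coefficient 0.\<close>
  let ?D = "\<lambda>\<theta>. if l \<in># fst \<theta> then C (fst \<theta> - {#l#}, snd \<theta>) else 0"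
  let ?h = "\<lambda>\<theta>. (add_mset l (fst \<theta>), snd \<theta>) :: nat multiset \<times> nat"
  have img: "?h ` types (Suc n) = {\<theta>\<in>types (Suc (n + l)). l \<in># fst \<theta>}"
  proof (intro equalityI subsetI)
    fix \<theta> assume "\<theta> \<in> {\<theta>\<in>types (Suc (n + l)). l \<in># fst \<theta>}"
    then have "\<theta> = ?h (fst \<theta> - {#l#}, snd \<theta>)" "(fst \<theta> - {#l#}, snd \<theta>) \<in> types (Suc n)"
      by (auto simp: types_def dest!: multi_member_split)
    then show "\<theta> \<in> ?h ` types (Suc n)" by blast
  qed (use mult.hyps in \<open>auto simp: types_def\<close>)
  have inj: "inj_on ?h (types (Suc n))" by (rule inj_onI) (auto simp: prod_eq_iff)
  have "(\<Sum>\<theta>\<in>types (Suc (n + l)). of_real (?D \<theta>) * marked_basis A t x \<theta>) =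
      (\<Sum>\<theta>\<in>{\<theta>\<in>types (Suc (n + l)). l \<in># fst \<theta>}. of_real (?D \<theta>) * marked_basis A t x \<theta>)" for t x
    by (rule sum.mono_neutral_right) (auto simp: finite_types)
  also have "\<dots> t x = (\<Sum>\<theta>\<in>types (Suc n). of_real (C \<theta>) * (E t l * marked_basis A t x \<theta>))" for t x
    unfolding img[symmetric] sum.reindex[OF inj]
    by (intro sum.cong) (auto simp: marked_basis_def ac_simps)
  finally have "(\<Sum>\<theta>\<in>types (Suc (n + l)). of_real (?D \<theta>) * marked_basis A t x \<theta>) =
      (\<Sum>\<theta>\<in>types (Suc n). of_real (C \<theta>) * (E t l * marked_basis A t x \<theta>))" for t x .
  then show ?case
    by (intro exI[of _ ?D]) (use C in \<open>auto simp: sum_distrib_left ac_simps\<close>)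
next
  case (ext n f g)
  then obtain C where C: "\<forall>\<theta>. 0 \<le> C \<theta>"
    "\<And>t x. x \<in> A \<Longrightarrow> f t x = (\<Sum>\<theta>\<in>types (Suc n). of_real (C \<theta>) * marked_basis A t x \<theta>)"
    by blast
  then show ?case using ext.hyps(2) by (intro exI[of _ C]) auto
qed

section \<open>Independence of the marked basis\<close>

lemma poly_coeffs_zero:
  fixes c :: "nat \<Rightarrow> complex"
  assumes "finite R" "\<And>z. (\<Sum>r\<in>R. c r * z ^ r) = 0" "r \<in> R"
  shows "c r = 0"
proof -
  define p where "p = (\<Sum>r\<in>R. monom (c r) r)"
  have "poly p z = 0" for z
    using assms(2)[of z] by (simp add: p_def poly_sum poly_monom)
  then have "p = 0" using poly_all_0_iff_0 by blast
  moreover have "coeff p r = c r"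
    using assms(1,3) by (simp add: p_def coeff_sum)
  ultimately show ?thesis by simp
qed

text \<open>Grouping by the multiplicity of v makes the sum a polynomial in the value e v. Its
  coefficients vanish and involve only the remaining variables, to which the induction
  applies.\<close>

lemma monomials_independent:
  fixes D :: "nat multiset \<Rightarrow> complex"
  assumes "finite V" "finite \<Lambda>" "\<And>L. L \<in> \<Lambda> \<Longrightarrow> set_mset L \<subseteq> V"
    and "\<And>e. (\<Sum>L\<in>\<Lambda>. D L * (\<Prod>l\<in>#L. e l)) = 0" and "L \<in> \<Lambda>"
  shows "D L = 0"
  using assms
proof (induction V arbitrary: \<Lambda> D L rule: finite_induct)
  case empty
  then have "\<Lambda> \<subseteq> {{#}}" by auto
  with empty.prems(4) have "\<Lambda> = {{#}}" "L = {#}" by auto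
  then show ?case using empty.prems(3) by simp
next
  case (insert v V)
  define r where "r = count L v"
  define G where "G k = {K \<in> \<Lambda>. count K v = k}" for k
  let ?f = "filter_mset (\<lambda>l. l \<noteq> v)"
  have K_eq: "K = ?f K + replicate_mset (count K v) v" for K :: "nat multiset"
    by (metis add.commute filter_eq_replicate_mset multiset_partition)
  have inj: "inj_on ?f (G r)"
    by (rule inj_onI) (metis (mono_tags, lifting) G_def K_eq mem_Collect_eq)
  have "(\<Sum>K\<in>G r. D K * (\<Prod>l\<in>#?f K. e l)) = 0" for e
  proof (rule poly_coeffs_zero[where R = "(\<lambda>K. count K v) ` \<Lambda>" and r = r
        and c = "\<lambda>k. \<Sum>K\<in>G k. D K * (\<Prod>l\<in>#?f K. e l)"])
    fix z
    have e: "(\<Prod>l\<in>#K. (e(v := z)) l) = (\<Prod>l\<in>#?f K. e l) * z ^ count K v" for K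
    proof -
      have "(\<Prod>l\<in>#?f K. (e(v := z)) l) = (\<Prod>l\<in>#?f K. e l)"
        by (intro arg_cong[of _ _ prod_mset] image_mset_cong) auto
      then show ?thesis by (subst K_eq[of K]) (simp del: fun_upd_apply add: fun_upd_same)
    qed
    have "(\<Sum>k\<in>(\<lambda>K. count K v) ` \<Lambda>. (\<Sum>K\<in>G k. D K * (\<Prod>l\<in>#?f K. e l)) * z ^ k) =
        (\<Sum>k\<in>(\<lambda>K. count K v) ` \<Lambda>. \<Sum>K\<in>G k. D K * (\<Prod>l\<in>#K. (e(v := z)) l))"
      unfolding sum_distrib_right by (intro sum.cong refl) (auto simp: G_def e simp del: fun_upd_apply)
    also have "\<dots> = (\<Sum>K\<in>\<Lambda>. D K * (\<Prod>l\<in>#K. (e(v := z)) l))"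
      unfolding G_def by (rule sum.image_gen[symmetric]) (rule insert.prems(1))
    also have "\<dots> = 0" by (rule insert.prems(3))
    finally show "(\<Sum>k\<in>(\<lambda>K. count K v) ` \<Lambda>. (\<Sum>K\<in>G k. D K * (\<Prod>l\<in>#?f K. e l)) * z ^ k) = 0" .
  qed (use insert.prems in \<open>auto simp: r_def\<close>)
  moreover have "(\<Sum>K\<in>?f ` G r. D (K + replicate_mset r v) * (\<Prod>l\<in>#K. e l)) =
      (\<Sum>K\<in>G r. D K * (\<Prod>l\<in>#?f K. e l))" for e
  proof -
    have "D (?f K + replicate_mset r v) = D K" if "K \<in> G r" for K
      using K_eq[of K] that by (simp add: G_def)
    then show ?thesis by (simp add: sum.reindex[OF inj])
  qed
  ultimately have "(\<Sum>K\<in>?f ` G r. D (K + replicate_mset r v) * (\<Prod>l\<in>#K. e l)) = 0" for e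
    by simp
  then have "D (?f L + replicate_mset r v) = 0"
    by (rule insert.IH[rotated 2])
      (use insert.prems in \<open>fastforce simp: G_def r_def\<close>)+
  then show ?case using K_eq[of L] by (simp add: r_def)
qed

text \<open>In terms of generating functions, 1 + e_1 X + ... has to be a product of factors 1 + t_i
  X. A root z of the reversed polynomial splits off the factor 1 - z X.\<close>

lemma ex_weights_esym:
  fixes e :: "nat \<Rightarrow> complex"
  assumes "e 0 = 1"
  shows "\<exists>t. \<forall>k\<le>n. esym {1..n} t k = e k"
  using assms
proof (induction n arbitrary: e)
  case 0
  then show ?case by simp
next
  case (Suc n)
  define p where "p = (\<Sum>i\<le>Suc n. monom (e (Suc n - i)) i)"
  have cp: "coeff p i = (if i \<le> Suc n then e (Suc n - i) else 0)" for i
    by (simp add: p_def coeff_sum)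
  have "\<not> constant (poly p)"
  proof
    assume "constant (poly p)"
    then have "degree p = 0" by (simp add: constant_degree)
    then have "coeff p (Suc n) = 0" by (simp add: coeff_eq_0)
    then show False using Suc.prems by (simp add: cp)
  qed
  then obtain z where z: "poly p z = 0" using fundamental_theorem_of_algebra by blast
  \<comment> \<open>Coefficients of the quotient by 1 - z X. That z is a root means that the
    coefficient at n + 1 vanishes, so n letters suffice for the quotient.\<close>
  define f where "f k = (\<Sum>i\<le>k. z ^ i * e (k - i))" for k
  have f_last: "f (Suc n) = 0"
    using z by (simp add: f_def p_def poly_sum poly_monom mult.commute)
  have f_Suc: "f (Suc k) = e (Suc k) + z * f k" for k
    unfolding f_def by (subst sum.atMost_Suc_shift) (simp add: sum_distrib_left mult.assoc)
  have "f 0 = 1" using Suc.prems by (simp add: f_def)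
  then obtain t where t: "\<forall>k\<le>n. esym {1..n} t k = f k" using Suc.IH by blast
  define s where "s = t(Suc n := - z)"
  have s: "esym {1..n} s k = esym {1..n} t k" for k
    unfolding esym_def s_def by (intro sum.cong prod.cong) auto
  have "esym {1..Suc n} s k = e k" if "k \<le> Suc n" for k
  proof (cases k)
    case 0
    then show ?thesis using Suc.prems by simp
  next
    case (Suc j)
    have A: "{1..Suc n} = insert (Suc n) {1..n}" "Suc n \<notin> {1..n}" by auto
    have "esym {1..Suc n} s (Suc j) = esym {1..n} t (Suc j) - z * esym {1..n} t j"
      unfolding A(1) esym_insert[OF finite_atLeastAtMost A(2)] s by (simp add: s_def)
    also have "esym {1..n} t j = f j" using t Suc that by simp
    also have "esym {1..n} t (Suc j) = f (Suc j)"
      using t Suc that f_last by (cases "Suc j \<le> n") (auto simp: le_Suc_eq esym_eq_0)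
    finally show ?thesis by (simp add: f_Suc Suc)
  qed
  then show ?case by blast
qed

text \<open>The value that e_k(A - {x}) is forced to have by t(x) = z and e_j(A) = e j: the
  coefficients of the quotient by 1 + z X.\<close>

definition marked_esym :: "(nat \<Rightarrow> complex) \<Rightarrow> complex \<Rightarrow> nat \<Rightarrow> complex" where
  "marked_esym e z k = (\<Sum>i\<le>k. (- z) ^ i * e (k - i))"

lemma ex_weights_marked:
  fixes e :: "nat \<Rightarrow> complex"
  assumes "e 0 = 1"
  shows "\<exists>t. t (Suc n) = z \<and> (\<forall>k\<le>n. esym {1..Suc n} t k = e k) \<and>
    (\<forall>k\<le>n. esym ({1..Suc n} - {Suc n}) t k = marked_esym e z k)"
proof -
  have m_Suc: "marked_esym e z (Suc k) = e (Suc k) - z * marked_esym e z k" for k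
    unfolding marked_esym_def
    by (subst sum.atMost_Suc_shift) (simp add: sum_distrib_left sum_negf mult.assoc)
  have m0: "marked_esym e z 0 = 1" using assms by (simp add: marked_esym_def)
  then obtain t where t: "\<forall>k\<le>n. esym {1..n} t k = marked_esym e z k"
    using ex_weights_esym by blast
  define s where "s = t(Suc n := z)"
  have s: "esym {1..n} s k = esym {1..n} t k" for k
    unfolding esym_def s_def by (intro sum.cong prod.cong) auto
  have A: "{1..Suc n} = insert (Suc n) {1..n}" "{1..Suc n} - {Suc n} = {1..n}" "Suc n \<notin> {1..n}" by auto
  have "esym {1..Suc n} s k = e k" if "k \<le> n" for k
  proof (cases k)
    case (Suc j)
    have "esym {1..Suc n} s (Suc j) = esym {1..n} t (Suc j) + z * esym {1..n} t j"
      unfolding A(1) esym_insert[OF finite_atLeastAtMost A(3)] s by (simp add: s_def)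
    then show ?thesis using t Suc that m_Suc[of j] by simp
  qed (use assms in simp)
  then show ?thesis
    using t s unfolding A(2) by (intro exI[of _ s]) (auto simp: s_def)
qed

text \<open>First e is fixed and z varies: z times \<open>marked_esym e z (b - 1)\<close> is a
  polynomial in z of degree exactly b, so different b separate. Then e varies and the multisets L
  separate by \<open>monomials_independent\<close>.\<close>

theorem marked_basis_independent:
  fixes D :: "nat multiset \<times> nat \<Rightarrow> complex"
  assumes D: "\<And>t. (\<Sum>\<theta>\<in>types n. D \<theta> * marked_basis {1..Suc n} t (Suc n) \<theta>) = 0"
    and "\<theta> \<in> types n"
  shows "D \<theta> = 0"
proof -
  have e0: "D (L, b) = 0" if Lb: "(L, b) \<in> types n" for L b
  proof -
    define \<Lambda> where "\<Lambda> b = {L. (L, b) \<in> types n}" for b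
    have fin: "finite (\<Lambda> b)" for b
      by (rule finite_subset[of _ "fst ` types n"]) (force simp: \<Lambda>_def finite_types)+
    define c where "c e b = (\<Sum>L\<in>\<Lambda> b. D (L, b) * (\<Prod>l\<in>#L. e l))" for e :: "nat \<Rightarrow> complex" and b
    have sum_c: "(\<Sum>b=1..n. c e b * (z * marked_esym e z (b - 1))) = 0" if e0: "e 0 = 1" for e z
    proof -
      obtain t where t: "t (Suc n) = z" "\<And>k. k \<le> n \<Longrightarrow> esym {1..Suc n} t k = e k"
        "\<And>k. k \<le> n \<Longrightarrow> esym ({1..Suc n} - {Suc n}) t k = marked_esym e z k"
        using ex_weights_marked[of e n z, OF e0] by blast
      have "(\<Sum>b=1..n. c e b * (z * marked_esym e z (b - 1))) =
          (\<Sum>b=1..n. \<Sum>L\<in>\<Lambda> b. D (L, b) * ((\<Prod>l\<in>#L. e l) * (z * marked_esym e z (b - 1))))"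
        unfolding c_def sum_distrib_right by (simp add: mult.assoc)
      also have "\<dots> = (\<Sum>b=1..n. \<Sum>L\<in>\<Lambda> b. D (L, b) * marked_basis {1..Suc n} t (Suc n) (L, b))"
      proof (intro sum.cong refl)
        fix b L assume *: "b \<in> {1..n}" "L \<in> \<Lambda> b"
        have "l \<le> n" if "l \<in># L" for l
          using * that by (auto simp: \<Lambda>_def types_def dest!: multi_member_split)
        then have "(\<Prod>l\<in>#L. esym {1..Suc n} t l) = (\<Prod>l\<in>#L. e l)"
          using t(2) by (intro arg_cong[of _ _ prod_mset] image_mset_cong) auto
        moreover have "esym ({1..Suc n} - {Suc n}) t (b - 1) = marked_esym e z (b - 1)"
          using * by (intro t(3)) auto
        ultimately show "D (L, b) * ((\<Prod>l\<in>#L. e l) * (z * marked_esym e z (b - 1))) =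
            D (L, b) * marked_basis {1..Suc n} t (Suc n) (L, b)"
          unfolding marked_basis_def fst_conv snd_conv t(1) by (simp only:)
      qed
      also have "\<dots> = (\<Sum>(b, L)\<in>Sigma {1..n} \<Lambda>. D (L, b) * marked_basis {1..Suc n} t (Suc n) (L, b))"
        using fin by (intro sum.Sigma) auto
      also have "\<dots> = (\<Sum>\<theta>\<in>types n. D \<theta> * marked_basis {1..Suc n} t (Suc n) \<theta>)"
        by (rule sum.reindex_bij_witness[of _ "\<lambda>(L, b). (b, L)" "\<lambda>(b, L). (L, b)"])
          (auto simp: \<Lambda>_def types_def)
      finally show ?thesis using D by simp
    qed
    have c0: "c e b = 0" if e0: "e 0 = 1" and b: "b \<in> {1..n}" for e b
    proof (rule ccontr)
      assume "c e b \<noteq> 0"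
      \<comment> \<open>With m the largest index of a nonzero coefficient, larger b contribute
        nothing and smaller b have degree below m, so the coefficient at z^m comes from b = m
        alone.\<close>
      define S where "S = {b\<in>{1..n}. c e b \<noteq> 0}"
      define m where "m = Max S"
      have "m \<in> S" unfolding m_def
        by (rule Max_in) (use \<open>c e b \<noteq> 0\<close> b in \<open>auto simp: S_def\<close>)
      have "b' \<le> m" if "b' \<in> S" for b'
        unfolding m_def using that by (intro Max_ge) (auto simp: S_def)
      then have big: "c e b' = 0" if "b' \<in> {1..n}" "m < b'" for b'
        using that unfolding S_def by fastforce
      define q where "q b = (\<Sum>i\<le>b - 1. monom ((- 1) ^ i * e (b - 1 - i)) (Suc i))" for b
      have q: "poly (q b) z = z * marked_esym e z (b - 1)" for b z
        unfolding q_def marked_esym_def poly_sum poly_monom sum_distrib_left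
        by (intro sum.cong refl) (simp add: power_minus[of z] ac_simps)
      have "(\<Sum>b=1..n. smult (c e b) (q b)) = 0"
        using sum_c[of e, OF e0] q poly_all_0_iff_0[of "\<Sum>b=1..n. smult (c e b) (q b)"]
        by (simp add: poly_sum)
      then have "0 = coeff (\<Sum>b=1..n. smult (c e b) (q b)) m" by simp
      also have "\<dots> = (\<Sum>b=1..n. c e b * coeff (q b) m)" by (simp add: coeff_sum)
      also have "\<dots> = c e m * coeff (q m) m"
      proof -
        have "c e b * coeff (q b) m = 0" if "b \<in> {1..n} - {m}" for b
        proof (cases "m < b")
          case True
          then show ?thesis using big[of b] that by simp
        next
          case False
          then have "coeff (q b) m = 0"
            unfolding q_def coeff_sum using that by (intro sum.neutral) (auto simp: coeff_monom)
          then show ?thesis by simp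
        qed
        then have "(\<Sum>b\<in>{1..n} - {m}. c e b * coeff (q b) m) = 0" by (rule sum.neutral[OF ballI])
        moreover have "m \<in> {1..n}" using \<open>m \<in> S\<close> by (simp add: S_def)
        ultimately show ?thesis
          using sum.remove[of "{1..n}" m "\<lambda>b. c e b * coeff (q b) m"] by simp
      qed
      also have "coeff (q m) m = (- 1) ^ (m - 1)"
      proof -
        have "Suc i = m \<longleftrightarrow> i = m - 1" for i using \<open>m \<in> S\<close> by (auto simp: S_def)
        then show ?thesis unfolding q_def coeff_sum by (simp add: e0)
      qed
      finally show False using \<open>m \<in> S\<close> by (simp add: S_def)
    qed
    have b: "b \<in> {1..n}" using Lb by (auto simp: types_def)
    show ?thesis
    proof (rule monomials_independent[of "{1..n}" "\<Lambda> b" "\<lambda>L. D (L, b)"])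
      fix K assume "K \<in> \<Lambda> b"
      then show "set_mset K \<subseteq> {1..n}"
        by (auto simp: \<Lambda>_def types_def Suc_le_eq dest!: multi_member_split intro!: gr0I)
    next
      fix e :: "nat \<Rightarrow> complex"
      \<comment> \<open>Independence needs all e, weights exist only for e 0 = 1; since types have
        no part 0, the value at 0 may be reset.\<close>
      have "(\<Sum>L\<in>\<Lambda> b. D (L, b) * (\<Prod>l\<in>#L. e l)) = c (e(0 := 1)) b"
        unfolding c_def
        by (intro sum.cong refl arg_cong2[of _ _ _ _ "(*)"] arg_cong[of _ _ prod_mset] image_mset_cong)
          (auto simp: \<Lambda>_def types_def)
      then show "(\<Sum>L\<in>\<Lambda> b. D (L, b) * (\<Prod>l\<in>#L. e l)) = 0"
        using c0[of "e(0 := 1)" b] b by simp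
    qed (use Lb fin in \<open>auto simp: \<Lambda>_def\<close>)
  qed
  then show ?thesis using assms(2) by (cases \<theta>) simp
qed

section \<open>Proper words of the triangular ladder\<close>

definition words :: "nat \<Rightarrow> nat set \<Rightarrow> nat list set" where
  "words n A = {w. length w = n \<and> set w \<subseteq> A}"

lemma finite_words: "finite A \<Longrightarrow> finite (words n A)"
  using finite_lists_length_eq[of A n] by (simp add: words_def conj_commute)

definition tl_word :: "nat list \<Rightarrow> bool" where
  "tl_word w \<longleftrightarrow> (\<forall>i. Suc i < length w \<longrightarrow> w ! Suc i \<noteq> w ! i) \<and>
    (\<forall>i. Suc (Suc i) < length w \<longrightarrow> w ! Suc (Suc i) \<noteq> w ! i)"

lemma proper_word_TL_iff:
  assumes "length w = n"
  shows "proper_word n (TL n) w \<longleftrightarrow> tl_word w"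
proof
  assume p: "proper_word n (TL n) w"
  show "tl_word w"
    unfolding tl_word_def
  proof (intro conjI allI impI)
    fix i assume "Suc i < length w"
    then have "TL n (Suc (Suc i)) (Suc i)" "Suc (Suc i) \<in> {1..n}" "Suc i \<in> {1..n}"
      using assms by (auto simp: TL_def)
    then show "w ! Suc i \<noteq> w ! i" using p unfolding proper_word_def by fastforce
  next
    fix i assume "Suc (Suc i) < length w"
    then have "TL n (Suc (Suc (Suc i))) (Suc i)" "Suc (Suc (Suc i)) \<in> {1..n}" "Suc i \<in> {1..n}"
      using assms by (auto simp: TL_def)
    then show "w ! Suc (Suc i) \<noteq> w ! i" using p unfolding proper_word_def by fastforce
  qed
next
  assume t: "tl_word w"
  have *: "w ! i \<noteq> w ! j" if "j < n" "i < j" "j \<le> i + 2" for i j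
  proof -
    have "j = Suc i \<or> j = Suc (Suc i)" using that by auto
    then show ?thesis using t that assms unfolding tl_word_def by metis
  qed
  show "proper_word n (TL n) w"
    unfolding proper_word_def
  proof (intro ballI impI)
    fix i j assume ij: "i \<in> {1..n}" "j \<in> {1..n}" "TL n i j"
    then consider "i < j" "j \<le> i + 2" | "j < i" "i \<le> j + 2"
      by (auto simp: TL_def abs_if split: if_splits)
    then show "w ! (i - 1) \<noteq> w ! (j - 1)"
    proof cases
      case 1
      then show ?thesis using ij by (intro *) auto
    next
      case 2
      then show ?thesis using ij by (intro not_sym[OF *]) auto
    qed
  qed
qed

context finite_alphabet
begin

definition tl_tails :: "nat \<Rightarrow> nat \<Rightarrow> nat \<Rightarrow> nat list set" where
  "tl_tails m y x = {w \<in> words (m + 2) A. tl_word w \<and> w ! m = y \<and> w ! Suc m = x}"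

definition tail_sum :: "nat \<Rightarrow> (nat \<Rightarrow> complex) \<Rightarrow> nat \<Rightarrow> nat \<Rightarrow> complex" where
  "tail_sum m t y x = (\<Sum>w\<in>tl_tails m y x. prod_list (map t w))"

lemma finite_tl_tails: "finite (tl_tails m y x)"
  using finite_words[OF finite_A] by (simp add: tl_tails_def)

lemma tl_tails_0:
  assumes "x \<in> A" "y \<in> A" "x \<noteq> y"
  shows "tl_tails 0 y x = {[y, x]}"
  using assms unfolding tl_tails_def words_def tl_word_def
  by (auto simp: length_Suc_conv numeral_2_eq_2)

lemma tl_tails_Suc:
  assumes "x \<in> A" "x \<noteq> y"
  shows "tl_tails (Suc m) y x = (\<lambda>w. w @ [x]) ` (\<Union>a\<in>A - {x, y}. tl_tails m a y)"
proof (intro equalityI subsetI)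
  fix v assume v: "v \<in> tl_tails (Suc m) y x"
  then have lv: "length v = Suc (Suc (Suc m))" "set v \<subseteq> A" by (auto simp: tl_tails_def words_def)
  define w where "w = butlast v"
  have "v \<noteq> []" using lv by auto
  moreover from this have "last v = x"
    using v lv(1) by (simp add: tl_tails_def last_conv_nth)
  ultimately have vw: "v = w @ [x]" unfolding w_def by (metis append_butlast_last_id)
  have lw: "length w = Suc (Suc m)" using lv vw by simp
  have tv: "tl_word v" "v ! Suc m = y" using v by (auto simp: tl_tails_def)
  have nth: "w ! i = v ! i" if "i < Suc (Suc m)" for i using that lw vw by (simp add: nth_append)
  have "tl_word w"
    using tv(1) lv(1) lw nth unfolding tl_word_def by simp
  moreover have "w ! m \<noteq> x" "w ! m \<noteq> y"
  proof -
    have "v ! Suc (Suc m) \<noteq> v ! m" "v ! Suc m \<noteq> v ! m"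
      using tv(1) lv(1) by (simp_all add: tl_word_def)
    then show "w ! m \<noteq> x" "w ! m \<noteq> y"
      using tv(2) v nth[of m] by (auto simp: tl_tails_def)
  qed
  moreover have "w ! m \<in> A" using lv lw vw by (auto intro!: subsetD[OF lv(2)])
  ultimately have "w \<in> (\<Union>a\<in>A - {x, y}. tl_tails m a y)"
    using lv lw vw tv nth[of "Suc m"] by (auto simp: tl_tails_def words_def)
  then show "v \<in> (\<lambda>w. w @ [x]) ` (\<Union>a\<in>A - {x, y}. tl_tails m a y)" using vw by blast
next
  fix v assume "v \<in> (\<lambda>w. w @ [x]) ` (\<Union>a\<in>A - {x, y}. tl_tails m a y)"
  then obtain a w where w: "a \<in> A - {x, y}" "w \<in> tl_tails m a y" "v = w @ [x]" by auto
  then have lw: "length w = Suc (Suc m)" "tl_word w" "set w \<subseteq> A" "w ! m = a" "w ! Suc m = y"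
    by (auto simp: tl_tails_def words_def)
  have "tl_word v"
    unfolding tl_word_def w(3)
  proof (intro conjI allI impI)
    fix i assume "Suc i < length (w @ [x])"
    then show "(w @ [x]) ! Suc i \<noteq> (w @ [x]) ! i"
      using lw w(1) assms(2) unfolding tl_word_def by (cases "i = Suc m") (auto simp: nth_append)
  next
    fix i assume "Suc (Suc i) < length (w @ [x])"
    then show "(w @ [x]) ! Suc (Suc i) \<noteq> (w @ [x]) ! i"
      using lw w(1) assms(2) unfolding tl_word_def by (cases "i = m") (auto simp: nth_append)
  qed
  then show "v \<in> tl_tails (Suc m) y x"
    using lw w assms by (auto simp: tl_tails_def words_def nth_append)
qed

lemma tail_sum_Suc:
  assumes "x \<in> A" "x \<noteq> y"
  shows "tail_sum (Suc m) t y x = append_letter (tail_sum m) t y x"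
proof -
  have "tail_sum (Suc m) t y x = (\<Sum>w\<in>(\<Union>a\<in>A - {x, y}. tl_tails m a y). prod_list (map t w) * t x)"
    unfolding tail_sum_def tl_tails_Suc[OF assms]
    by (subst sum.reindex) (auto intro: inj_onI)
  also have "\<dots> = (\<Sum>a\<in>A - {x, y}. \<Sum>w\<in>tl_tails m a y. prod_list (map t w) * t x)"
    by (rule sum.UNION_disjoint) (use finite_A finite_tl_tails in \<open>auto simp: tl_tails_def\<close>)
  finally show ?thesis
    by (simp add: append_letter_def tail_sum_def sum_distrib_left sum_distrib_right mult.commute)
qed

lemma cone_tail_sum: "cone m (tail_sum m)"
proof (induction m)
  case 0
  \<comment> \<open>The only word is [y, x], and t(y) t(x) is the \<open>joint\<close> function with
    k = 0.\<close>
  show ?case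
    by (rule cone.ext[OF cone.joint]) (simp add: tail_sum_def tl_tails_0 finite_A)
next
  case (Suc m)
  show ?case
    by (rule cone.ext[OF cone_append_letter[OF Suc.IH]]) (simp add: tail_sum_Suc)
qed

lemma unmark_tail_sum:
  "unmark_fst (tail_sum m) t x =
    (\<Sum>w\<in>{w \<in> words (m + 2) A. tl_word w \<and> w ! Suc m = x}. prod_list (map t w))"
proof -
  have "{w \<in> words (m + 2) A. tl_word w \<and> w ! Suc m = x} = (\<Union>y\<in>A - {x}. tl_tails m y x)"
  proof (intro equalityI subsetI)
    fix w assume w: "w \<in> {w \<in> words (m + 2) A. tl_word w \<and> w ! Suc m = x}"
    then have "w ! m \<in> A" by (auto simp: words_def intro!: subsetD[of "set w" A])
    moreover have "w ! m \<noteq> x" using w by (auto simp: tl_word_def words_def)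
    ultimately show "w \<in> (\<Union>y\<in>A - {x}. tl_tails m y x)" using w by (auto simp: tl_tails_def)
  qed (auto simp: tl_tails_def)
  moreover have "(\<Sum>w\<in>(\<Union>y\<in>A - {x}. tl_tails m y x). prod_list (map t w)) = unmark_fst (tail_sum m) t x"
    unfolding unmark_fst_def tail_sum_def
    by (rule sum.UNION_disjoint) (use finite_A finite_tl_tails in \<open>auto simp: tl_tails_def\<close>)
  ultimately show ?thesis by simp
qed

theorem spos_tl_words:
  assumes "1 \<le> n"
  shows "spos (n - 1) (\<lambda>t x. \<Sum>w\<in>{w \<in> words n A. tl_word w \<and> w ! (n - 1) = x}. prod_list (map t w))"
\<comment> \<open>A one-letter word has no penultimate letter to sum over; its weight t(x) is itself
  a generator.\<close>
proof (cases "n = 1")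
  case True
  show ?thesis
  proof (rule spos.ext)
    show "spos (n - 1) (\<lambda>t x. t x * eps t x 0)" unfolding True by (simp only: diff_self_eq_0 spos.gen)
    fix t x assume "x \<in> A"
    then have "{w \<in> words n A. tl_word w \<and> w ! (n - 1) = x} = {[x]}"
      unfolding True by (auto simp: words_def tl_word_def length_Suc_conv)
    then show "t x * eps t x 0 = (\<Sum>w\<in>{w \<in> words n A. tl_word w \<and> w ! (n - 1) = x}. prod_list (map t w))"
      by (simp add: finite_A)
  qed
next
  case False
  then obtain m where "n = m + 2" using assms by (metis One_nat_def Suc_1 add.commute le_Suc_eq le_add_diff_inverse2 not_less_eq_eq)
  then show ?thesis
    using cone_unmark_fst[OF cone_tail_sum[of m]] unfolding unmark_tail_sum[abs_def]
    by (simp add: eval_nat_numeral)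
qed

end

section \<open>Images of the functions e_pi\<close>

text \<open>Colorings as extensional maps on the positions, so that a sum over a disjoint union of
  blocks factors over the blocks.\<close>

definition proper_maps :: "'b set set \<Rightarrow> 'b set \<Rightarrow> 'c set \<Rightarrow> ('b \<Rightarrow> 'c) set" where
  "proper_maps P S A = {f \<in> S \<rightarrow>\<^sub>E A. \<forall>B\<in>P. inj_on f B}"

lemma sum_inj_marked:
  fixes t :: "'c \<Rightarrow> 'a::comm_ring_1"
  assumes "finite B" "finite A" "b \<notin> B" "x \<in> A"
  shows "(\<Sum>f | f \<in> insert b B \<rightarrow>\<^sub>E A \<and> inj_on f (insert b B) \<and> f b = x. \<Prod>i\<in>insert b B. t (f i)) =
    t x * (\<Sum>f | f \<in> B \<rightarrow>\<^sub>E (A - {x}) \<and> inj_on f B. \<Prod>i\<in>B. t (f i))"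
proof -
  have upd: "(\<Prod>i\<in>B. t ((f(b := y)) i)) = (\<Prod>i\<in>B. t (f i))" for f y
    using assms(3) by (intro prod.cong) auto
  have "(\<Sum>f | f \<in> insert b B \<rightarrow>\<^sub>E A \<and> inj_on f (insert b B) \<and> f b = x. \<Prod>i\<in>insert b B. t (f i)) =
      (\<Sum>f | f \<in> B \<rightarrow>\<^sub>E (A - {x}) \<and> inj_on f B. t x * (\<Prod>i\<in>B. t (f i)))"
  proof (rule sum.reindex_bij_witness[of _ "\<lambda>g. g(b := x)" "\<lambda>f. f(b := undefined)"])
    fix f assume f: "f \<in> {f \<in> insert b B \<rightarrow>\<^sub>E A. inj_on f (insert b B) \<and> f b = x}"
    then show "(f(b := undefined))(b := x) = f" by auto
    show "f(b := undefined) \<in> {f \<in> B \<rightarrow>\<^sub>E (A - {x}). inj_on f B}"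
    proof -
      have "f i \<in> A - {x}" if "i \<in> B" for i
        using f that assms(3) by (auto simp: PiE_iff inj_on_def)
      moreover have "inj_on (f(b := undefined)) B"
        using f assms(3) by (auto simp: inj_on_def)
      ultimately show ?thesis using f assms(3) by (auto simp: PiE_iff extensional_def)
    qed
    show "t x * (\<Prod>i\<in>B. t ((f(b := undefined)) i)) = (\<Prod>i\<in>insert b B. t (f i))"
      unfolding upd using f assms by simp
  next
    fix g assume g: "g \<in> {f \<in> B \<rightarrow>\<^sub>E (A - {x}). inj_on f B}"
    show "(g(b := x))(b := undefined) = g"
      using g assms(3) by (auto simp: PiE_iff extensional_def fun_eq_iff)
    have "inj_on (g(b := x)) (insert b B)"
      using g assms(3) by (auto simp: inj_on_def PiE_iff)
    then show "g(b := x) \<in> {f \<in> insert b B \<rightarrow>\<^sub>E A. inj_on f (insert b B) \<and> f b = x}"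
      using g assms(3,4) by (auto simp: PiE_iff extensional_def)
  qed
  then show ?thesis by (simp only: sum_distrib_left)
qed

text \<open>Each subset of size card B is the image of (card B)! injections. In the induction,
  fixing the value x at b removes x from the alphabet, and \<open>sum_marked_esym\<close> adds up
  over x.\<close>

lemma sum_inj:
  fixes t :: "'c \<Rightarrow> 'a::comm_ring_1"
  assumes "finite B" "finite A"
  shows "(\<Sum>f | f \<in> B \<rightarrow>\<^sub>E A \<and> inj_on f B. \<Prod>i\<in>B. t (f i)) = of_nat (fact (card B)) * esym A t (card B)"
  using assms
proof (induction B arbitrary: A rule: finite_induct)
  case empty
  have "{f. f \<in> {} \<rightarrow>\<^sub>E A \<and> inj_on f {}} = {\<lambda>_. undefined}" by auto
  then show ?case using empty by simp
next
  case (insert b B)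
  let ?F = "{f. f \<in> insert b B \<rightarrow>\<^sub>E A \<and> inj_on f (insert b B)}"
  have fin: "finite ?F"
    using insert by (intro finite_subset[OF _ finite_PiE[of "insert b B" "\<lambda>_. A"]]) auto
  have "(\<Sum>f\<in>?F. \<Prod>i\<in>insert b B. t (f i)) =
      (\<Sum>x\<in>A. \<Sum>f | f \<in> ?F \<and> f b = x. \<Prod>i\<in>insert b B. t (f i))"
    by (rule sum.group[symmetric]) (use insert fin in auto)
  also have "\<dots> = (\<Sum>x\<in>A. t x * (\<Sum>f | f \<in> B \<rightarrow>\<^sub>E (A - {x}) \<and> inj_on f B. \<Prod>i\<in>B. t (f i)))"
  proof (rule sum.cong)
    fix x assume "x \<in> A"
    then show "(\<Sum>f | f \<in> ?F \<and> f b = x. \<Prod>i\<in>insert b B. t (f i)) =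
        t x * (\<Sum>f | f \<in> B \<rightarrow>\<^sub>E (A - {x}) \<and> inj_on f B. \<Prod>i\<in>B. t (f i))"
      using sum_inj_marked[of B A b x t] insert by (simp add: conj_assoc)
  qed simp
  also have "\<dots> = (\<Sum>x\<in>A. t x * (of_nat (fact (card B)) * esym (A - {x}) t (card B)))"
    using insert by (intro sum.cong refl) simp
  also have "\<dots> = of_nat (fact (card B)) * (\<Sum>x\<in>A. t x * esym (A - {x}) t (card B))"
    by (simp add: sum_distrib_left ac_simps)
  also have "\<dots> = of_nat (fact (card (insert b B))) * esym A t (card (insert b B))"
    unfolding sum_marked_esym[OF insert.prems] using insert.hyps by (simp add: algebra_simps)
  finally show ?case .
qed

lemma sum_PiE_Un:
  fixes F G :: "('b \<Rightarrow> 'c) \<Rightarrow> 'a::comm_ring_1"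
  assumes "S \<inter> T = {}"
    and F: "\<And>f g. (\<And>i. i \<in> S \<Longrightarrow> f i = g i) \<Longrightarrow> F f = F g"
    and G: "\<And>f g. (\<And>i. i \<in> T \<Longrightarrow> f i = g i) \<Longrightarrow> G f = G g"
  shows "(\<Sum>f\<in>S \<union> T \<rightarrow>\<^sub>E A. F f * G f) = (\<Sum>f\<in>S \<rightarrow>\<^sub>E A. F f) * (\<Sum>f\<in>T \<rightarrow>\<^sub>E A. G f)"
proof -
  have "(\<Sum>f\<in>S \<union> T \<rightarrow>\<^sub>E A. F f * G f) = (\<Sum>(f, g)\<in>(S \<rightarrow>\<^sub>E A) \<times> (T \<rightarrow>\<^sub>E A). F f * G g)"
  proof (rule sum.reindex_bij_witness[of _ "\<lambda>(f, g) i. if i \<in> S then f i else g i"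
        "\<lambda>h. (restrict h S, restrict h T)"])
    fix h assume h: "h \<in> S \<union> T \<rightarrow>\<^sub>E A"
    then show "(\<lambda>(f, g) i. if i \<in> S then f i else g i) (restrict h S, restrict h T) = h"
      by (auto simp: fun_eq_iff restrict_def PiE_iff extensional_def)
    show "(restrict h S, restrict h T) \<in> (S \<rightarrow>\<^sub>E A) \<times> (T \<rightarrow>\<^sub>E A)"
      using h by (auto simp: PiE_iff)
    have "F (restrict h S) = F h" "G (restrict h T) = G h" by (auto intro: F G)
    then show "(case (restrict h S, restrict h T) of (f, g) \<Rightarrow> F f * G g) = F h * G h" by simp
  next
    fix p assume p: "p \<in> (S \<rightarrow>\<^sub>E A) \<times> (T \<rightarrow>\<^sub>E A)"
    obtain f g where fg: "p = (f, g)" by (cases p)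
    show "(\<lambda>(f, g) i. if i \<in> S then f i else g i) p \<in> S \<union> T \<rightarrow>\<^sub>E A"
      using p fg by (auto simp: PiE_iff extensional_def)
    have 1: "restrict (\<lambda>i. if i \<in> S then f i else g i) S = f"
      using p fg by (auto simp: fun_eq_iff restrict_def PiE_iff extensional_def)
    have 2: "restrict (\<lambda>i. if i \<in> S then f i else g i) T = g"
      using p fg assms(1) by (auto simp: fun_eq_iff restrict_def PiE_iff extensional_def)
    show "(restrict ((\<lambda>(f, g) i. if i \<in> S then f i else g i) p) S,
        restrict ((\<lambda>(f, g) i. if i \<in> S then f i else g i) p) T) = p"
      using 1 2 fg by simp
  qed
  then show ?thesis by (simp add: sum_product sum.cartesian_product)
qed

lemma sum_proper_maps:
  fixes t :: "'c \<Rightarrow> 'a::comm_ring_1"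
  assumes "finite P" "finite A" "disjoint P" "\<And>B. B \<in> P \<Longrightarrow> finite B"
  shows "(\<Sum>f\<in>proper_maps P (\<Union>P) A. \<Prod>i\<in>\<Union>P. t (f i)) = (\<Prod>B\<in>P. of_nat (fact (card B)) * esym A t (card B))"
  using assms
proof (induction P rule: finite_induct)
  case empty
  have "(proper_maps {} {} A :: ('b \<Rightarrow> 'c) set) = {\<lambda>_. undefined}" by (auto simp: proper_maps_def)
  then show ?case by simp
next
  case (insert B P)
  let ?F = "\<lambda>f. if inj_on f B then \<Prod>i\<in>B. t (f i) else 0"
  let ?G = "\<lambda>f. if \<forall>B\<in>P. inj_on f B then \<Prod>i\<in>\<Union>P. t (f i) else 0"
  have dj: "B \<inter> \<Union>P = {}"
    using insert.prems(2) insert.hyps(2) by (auto simp: disjoint_def)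
  have fin: "finite B" "finite (\<Union>P)" using insert by auto
  have "(\<Sum>f\<in>proper_maps (insert B P) (\<Union>(insert B P)) A. \<Prod>i\<in>\<Union>(insert B P). t (f i)) =
      (\<Sum>f\<in>B \<union> \<Union>P \<rightarrow>\<^sub>E A. if \<forall>C\<in>insert B P. inj_on f C then \<Prod>i\<in>B \<union> \<Union>P. t (f i) else 0)"
    unfolding proper_maps_def Union_insert
    by (rule sum.inter_filter) (use fin insert.prems in \<open>auto intro!: finite_PiE\<close>)
  also have "\<dots> = (\<Sum>f\<in>B \<union> \<Union>P \<rightarrow>\<^sub>E A. ?F f * ?G f)"
    using fin dj by (intro sum.cong refl) (auto simp: prod.union_disjoint)
  also have "\<dots> = (\<Sum>f\<in>B \<rightarrow>\<^sub>E A. ?F f) * (\<Sum>f\<in>\<Union>P \<rightarrow>\<^sub>E A. ?G f)"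
  proof (rule sum_PiE_Un[OF dj])
    fix f g :: "'b \<Rightarrow> 'c"
    assume "\<And>i. i \<in> B \<Longrightarrow> f i = g i"
    then show "?F f = ?F g" by (auto cong: inj_on_cong intro!: prod.cong)
  next
    fix f g :: "'b \<Rightarrow> 'c"
    assume eq: "\<And>i. i \<in> \<Union>P \<Longrightarrow> f i = g i"
    then have "inj_on f C = inj_on g C" if "C \<in> P" for C
      using that by (intro inj_on_cong) auto
    moreover have "(\<Prod>i\<in>\<Union>P. t (f i)) = (\<Prod>i\<in>\<Union>P. t (g i))"
      using eq by (intro prod.cong) auto
    ultimately show "?G f = ?G g" by simp
  qed
  also have "(\<Sum>f\<in>B \<rightarrow>\<^sub>E A. ?F f) = (\<Sum>f | f \<in> B \<rightarrow>\<^sub>E A \<and> inj_on f B. \<Prod>i\<in>B. t (f i))"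
    by (rule sum.inter_filter[symmetric, unfolded Collect_mem_eq])
      (use fin insert.prems in \<open>auto intro!: finite_PiE\<close>)
  also have "\<dots> = of_nat (fact (card B)) * esym A t (card B)"
    by (rule sum_inj) (use fin insert.prems in auto)
  also have "(\<Sum>f\<in>\<Union>P \<rightarrow>\<^sub>E A. ?G f) = (\<Sum>f\<in>proper_maps P (\<Union>P) A. \<Prod>i\<in>\<Union>P. t (f i))"
    unfolding proper_maps_def
    by (rule sum.inter_filter[symmetric]) (use fin insert.prems in \<open>auto intro!: finite_PiE\<close>)
  also have "\<dots> = (\<Prod>B\<in>P. of_nat (fact (card B)) * esym A t (card B))"
    by (rule insert.IH) (use insert.prems in \<open>auto simp: disjoint_def\<close>)
  finally show ?case using insert.hyps by simp
qed

lemma sum_proper_maps_marked: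
  fixes t :: "'c \<Rightarrow> 'a::comm_ring_1"
  assumes "finite P" "finite A" "disjoint P" "\<And>C. C \<in> P \<Longrightarrow> finite C"
    and B: "B \<in> P" "b \<in> B" and x: "x \<in> A"
  shows "(\<Sum>f | f \<in> proper_maps P (\<Union>P) A \<and> f b = x. \<Prod>i\<in>\<Union>P. t (f i)) =
    t x * (of_nat (fact (card B - 1)) * esym (A - {x}) t (card B - 1)) *
    (\<Prod>C\<in>P - {B}. of_nat (fact (card C)) * esym A t (card C))"
proof -
  let ?Q = "P - {B}"
  let ?F = "\<lambda>f. if inj_on f B \<and> f b = x then \<Prod>i\<in>B. t (f i) else 0"
  let ?G = "\<lambda>f. if \<forall>B\<in>?Q. inj_on f B then \<Prod>i\<in>\<Union>?Q. t (f i) else 0"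
  have dj: "B \<inter> \<Union>?Q = {}"
    using assms(3) B(1) by (auto simp: disjoint_def)
  have U: "\<Union>P = B \<union> \<Union>?Q" using B(1) by auto
  have fin: "finite B" "finite (\<Union>?Q)" using assms by auto
  have "{f. f \<in> proper_maps P (\<Union>P) A \<and> f b = x} =
      {f \<in> B \<union> \<Union>?Q \<rightarrow>\<^sub>E A. (inj_on f B \<and> f b = x) \<and> (\<forall>C\<in>?Q. inj_on f C)}"
    unfolding U proper_maps_def using B(1) by auto
  then have "(\<Sum>f | f \<in> proper_maps P (\<Union>P) A \<and> f b = x. \<Prod>i\<in>\<Union>P. t (f i)) =
      (\<Sum>f\<in>B \<union> \<Union>?Q \<rightarrow>\<^sub>E A. if (inj_on f B \<and> f b = x) \<and> (\<forall>C\<in>?Q. inj_on f C)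
        then \<Prod>i\<in>B \<union> \<Union>?Q. t (f i) else 0)"
    unfolding U
    by (simp only:) (rule sum.inter_filter, use fin assms(2) in \<open>auto intro!: finite_PiE\<close>)
  also have "\<dots> = (\<Sum>f\<in>B \<union> \<Union>?Q \<rightarrow>\<^sub>E A. ?F f * ?G f)"
    using fin dj by (intro sum.cong refl) (auto simp: prod.union_disjoint)
  also have "\<dots> = (\<Sum>f\<in>B \<rightarrow>\<^sub>E A. ?F f) * (\<Sum>f\<in>\<Union>?Q \<rightarrow>\<^sub>E A. ?G f)"
  proof (rule sum_PiE_Un[OF dj])
    fix f g :: "'b \<Rightarrow> 'c"
    assume eq: "\<And>i. i \<in> B \<Longrightarrow> f i = g i"
    then have "inj_on f B = inj_on g B" by (rule inj_on_cong)
    moreover have "(\<Prod>i\<in>B. t (f i)) = (\<Prod>i\<in>B. t (g i))" using eq by (intro prod.cong) auto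
    ultimately show "?F f = ?F g" using eq B(2) by simp
  next
    fix f g :: "'b \<Rightarrow> 'c"
    assume eq: "\<And>i. i \<in> \<Union>?Q \<Longrightarrow> f i = g i"
    then have "inj_on f C = inj_on g C" if "C \<in> ?Q" for C
      using that by (intro inj_on_cong) auto
    moreover have "(\<Prod>i\<in>\<Union>?Q. t (f i)) = (\<Prod>i\<in>\<Union>?Q. t (g i))"
      using eq by (intro prod.cong) auto
    ultimately show "?G f = ?G g" by simp
  qed
  also have "(\<Sum>f\<in>\<Union>?Q \<rightarrow>\<^sub>E A. ?G f) = (\<Sum>f\<in>proper_maps ?Q (\<Union>?Q) A. \<Prod>i\<in>\<Union>?Q. t (f i))"
    unfolding proper_maps_def
    by (rule sum.inter_filter[symmetric]) (use fin assms(2) in \<open>auto intro!: finite_PiE\<close>)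
  also have "\<dots> = (\<Prod>C\<in>?Q. of_nat (fact (card C)) * esym A t (card C))"
    by (rule sum_proper_maps) (use assms in \<open>auto simp: disjoint_def\<close>)
  also have "(\<Sum>f\<in>B \<rightarrow>\<^sub>E A. ?F f) = (\<Sum>f | f \<in> B \<rightarrow>\<^sub>E A \<and> inj_on f B \<and> f b = x. \<Prod>i\<in>B. t (f i))"
    by (rule sum.inter_filter[symmetric, unfolded Collect_mem_eq])
      (use fin assms(2) in \<open>auto intro!: finite_PiE\<close>)
  also have "\<dots> = t x * (of_nat (fact (card B - 1)) * esym (A - {x}) t (card B - 1))"
  proof -
    have "insert b (B - {b}) = B" "card (B - {b}) = card B - 1" using B(2) fin by auto
    then show ?thesis
      using sum_inj_marked[of "B - {b}" A b x t] sum_inj[of "B - {b}" "A - {x}" t] fin assms(2) x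
      by simp
  qed
  finally show ?thesis .
qed

section \<open>Weighted word sums of set partitions and their types\<close>

definition block_proper :: "nat set set \<Rightarrow> nat list \<Rightarrow> bool" where
  "block_proper P w \<longleftrightarrow> (\<forall>B\<in>P. \<forall>j\<in>B. \<forall>k\<in>B. j \<noteq> k \<longrightarrow> w ! (j - 1) \<noteq> w ! (k - 1))"

text \<open>The predicate Q lets one bijection serve both the unrestricted sums and those with
  prescribed letter at vertex n.\<close>

lemma sum_words:
  fixes t :: "nat \<Rightarrow> 'a::comm_ring_1"
  assumes P: "\<Union>P = {1..n}"
  shows "(\<Sum>w | w \<in> words n A \<and> block_proper P w \<and> Q (\<lambda>i\<in>{1..n}. w ! (i - 1)). prod_list (map t w)) =
    (\<Sum>f | f \<in> proper_maps P (\<Union>P) A \<and> Q f. \<Prod>i\<in>\<Union>P. t (f i))"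
proof (rule sum.reindex_bij_witness[of _ "\<lambda>f. map (\<lambda>i. f (Suc i)) [0..<n]" "\<lambda>w. \<lambda>i\<in>{1..n}. w ! (i - 1)"])
  fix w assume w: "w \<in> {w. w \<in> words n A \<and> block_proper P w \<and> Q (\<lambda>i\<in>{1..n}. w ! (i - 1))}"
  then have lw: "length w = n" "set w \<subseteq> A" by (auto simp: words_def)
  show "map (\<lambda>i. (\<lambda>i\<in>{1..n}. w ! (i - 1)) (Suc i)) [0..<n] = w"
    using lw by (intro nth_equalityI) auto
  have "inj_on (\<lambda>i\<in>{1..n}. w ! (i - 1)) B" if "B \<in> P" for B
  proof (rule inj_onI)
    fix i j assume ij: "i \<in> B" "j \<in> B" "(\<lambda>i\<in>{1..n}. w ! (i - 1)) i = (\<lambda>i\<in>{1..n}. w ! (i - 1)) j"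
    then have "i \<in> {1..n}" "j \<in> {1..n}" using that P by auto
    then show "i = j" using ij w that by (auto simp: block_proper_def)
  qed
  moreover have "(\<lambda>i\<in>{1..n}. w ! (i - 1)) \<in> {1..n} \<rightarrow>\<^sub>E A"
    using lw by (auto intro!: subsetD[of "set w" A])
  ultimately show "(\<lambda>i\<in>{1..n}. w ! (i - 1)) \<in> {f. f \<in> proper_maps P (\<Union>P) A \<and> Q f}"
    using w by (simp add: proper_maps_def P)
  have "prod_list (map t w) = (\<Prod>i<n. t (w ! i))"
    using lw by (simp add: prod.list_conv_set_nth atLeast0LessThan)
  also have "\<dots> = (\<Prod>i\<in>{1..n}. t (w ! (i - 1)))"
    by (rule prod.reindex_bij_witness[of _ "\<lambda>i. i - 1" Suc]) auto
  finally show "(\<Prod>i\<in>\<Union>P. t ((\<lambda>i\<in>{1..n}. w ! (i - 1)) i)) = prod_list (map t w)"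
    by (simp add: P)
next
  fix f assume f: "f \<in> {f. f \<in> proper_maps P (\<Union>P) A \<and> Q f}"
  then have fA: "f \<in> {1..n} \<rightarrow>\<^sub>E A" by (auto simp: proper_maps_def P)
  have nth: "map (\<lambda>i. f (Suc i)) [0..<n] ! (i - 1) = f i" if "i \<in> {1..n}" for i
    using that by auto
  show eq: "(\<lambda>i\<in>{1..n}. map (\<lambda>i. f (Suc i)) [0..<n] ! (i - 1)) = f"
    using fA nth by (auto simp: fun_eq_iff restrict_def PiE_iff extensional_def)
  have "block_proper P (map (\<lambda>i. f (Suc i)) [0..<n])"
    unfolding block_proper_def
  proof (intro ballI impI)
    fix B j k assume *: "B \<in> P" "j \<in> B" "k \<in> B" "j \<noteq> k"
    then have "j \<in> {1..n}" "k \<in> {1..n}" using P by auto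
    then show "map (\<lambda>i. f (Suc i)) [0..<n] ! (j - 1) \<noteq> map (\<lambda>i. f (Suc i)) [0..<n] ! (k - 1)"
      unfolding nth[OF \<open>j \<in> {1..n}\<close>] nth[OF \<open>k \<in> {1..n}\<close>]
      using * f by (auto simp: proper_maps_def inj_on_def)
  qed
  moreover have "map (\<lambda>i. f (Suc i)) [0..<n] \<in> words n A"
    using fA by (auto simp: words_def)
  ultimately show "map (\<lambda>i. f (Suc i)) [0..<n] \<in>
      {w. w \<in> words n A \<and> block_proper P w \<and> Q (\<lambda>i\<in>{1..n}. w ! (i - 1))}"
    using f eq by simp
qed

lemma setparts_props:
  assumes "P \<in> setparts n"
  shows "\<Union>P = {1..n}" "disjoint P" "finite P" "\<And>B. B \<in> P \<Longrightarrow> finite B" "\<And>B. B \<in> P \<Longrightarrow> B \<noteq> {}"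
    "\<And>B. B \<in> P \<Longrightarrow> B \<subseteq> {1..n}"
proof -
  have p: "partition_on {1..n} P" using assms by (simp add: setparts_def)
  show U: "\<Union>P = {1..n}" "disjoint P" using p by (auto simp: partition_on_def)
  show "finite P" using p finite_elements by blast
  show "\<And>B. B \<in> P \<Longrightarrow> B \<subseteq> {1..n}" using U by blast
  then show "\<And>B. B \<in> P \<Longrightarrow> finite B" using finite_subset by blast
  show "\<And>B. B \<in> P \<Longrightarrow> B \<noteq> {}" using p by (auto simp: partition_on_def)
qed

lemma block_of_props:
  assumes "P \<in> setparts n" "i \<in> {1..n}"
  shows "block_of P i \<in> P" "i \<in> block_of P i"
proof -
  have "\<exists>!B. B \<in> P \<and> i \<in> B"
  proof (rule ex_ex1I)
    show "\<exists>B. B \<in> P \<and> i \<in> B" using setparts_props(1)[OF assms(1)] assms(2) by blast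
    show "B = C" if "B \<in> P \<and> i \<in> B" "C \<in> P \<and> i \<in> C" for B C
      using disjointD[OF setparts_props(2)[OF assms(1)], of B C] that by blast
  qed
  from theI'[OF this] show "block_of P i \<in> P" "i \<in> block_of P i"
    by (auto simp: block_of_def)
qed

definition part_type :: "nat \<Rightarrow> nat set set \<Rightarrow> nat multiset \<times> nat" where
  "part_type n P = (image_mset card (mset_set (P - {block_of P n})), card (block_of P n))"

text \<open>The factor that turns the marked basis function into the image of e_pi. The block of n
  contributes (b - 1)! since the letter at n is prescribed.\<close>

definition type_norm :: "nat multiset \<times> nat \<Rightarrow> nat" where
  "type_norm \<theta> = (\<Prod>l\<in>#fst \<theta>. fact l) * fact (snd \<theta> - 1)"

lemma sum_block_proper:
  fixes t :: "nat \<Rightarrow> 'a::comm_ring_1"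
  assumes P: "P \<in> setparts n" and A: "finite A"
  shows "(\<Sum>w | w \<in> words n A \<and> block_proper P w. prod_list (map t w)) =
    (\<Prod>l\<in>#image_mset card (mset_set P). of_nat (fact l) * esym A t l)"
proof -
  have "(\<Sum>w | w \<in> words n A \<and> block_proper P w. prod_list (map t w)) =
      (\<Prod>B\<in>P. of_nat (fact (card B)) * esym A t (card B))"
    using sum_words[where Q = "\<lambda>_. True" and t = t, OF setparts_props(1)[OF P], of A]
      sum_proper_maps[OF setparts_props(3)[OF P] A setparts_props(2)[OF P] setparts_props(4)[OF P], of t]
    by simp
  then show ?thesis by (simp add: prod_unfold_prod_mset image_mset.compositionality o_def)
qed

lemma sum_block_proper_marked:
  fixes t :: "nat \<Rightarrow> 'a::comm_ring_1"
  assumes P: "P \<in> setparts n" and A: "finite A" and n: "1 \<le> n" and x: "x \<in> A"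
  shows "(\<Sum>w | w \<in> words n A \<and> block_proper P w \<and> w ! (n - 1) = x. prod_list (map t w)) =
    of_nat (type_norm (part_type n P)) * marked_basis A t x (part_type n P)"
proof -
  let ?B = "block_of P n"
  have B: "?B \<in> P" "n \<in> ?B" using block_of_props[OF P, of n] n by auto
  have "(\<Sum>w | w \<in> words n A \<and> block_proper P w \<and> w ! (n - 1) = x. prod_list (map t w)) =
    t x * (of_nat (fact (card ?B - 1)) * esym (A - {x}) t (card ?B - 1)) *
    (\<Prod>C\<in>P - {?B}. of_nat (fact (card C)) * esym A t (card C))"
    using sum_words[where Q = "\<lambda>f. f n = x" and t = t, OF setparts_props(1)[OF P], of A] n
      sum_proper_maps_marked[OF setparts_props(3)[OF P] A setparts_props(2)[OF P]
        setparts_props(4)[OF P] B x, of t]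
    by simp
  also have "(\<Prod>C\<in>P - {?B}. of_nat (fact (card C)) * esym A t (card C)) =
      of_nat (\<Prod>C\<in>P - {?B}. fact (card C)) * (\<Prod>C\<in>P - {?B}. esym A t (card C))"
    by (simp add: prod.distrib)
  finally show ?thesis
    by (simp add: type_norm_def marked_basis_def part_type_def prod_unfold_prod_mset
        image_mset.compositionality o_def ac_simps)
qed

lemma part_type_in_types:
  assumes P: "P \<in> setparts n" and n: "1 \<le> n"
  shows "part_type n P \<in> types n"
proof -
  let ?B = "block_of P n"
  have B: "?B \<in> P" "n \<in> ?B" using block_of_props[OF P, of n] n by auto
  note props = setparts_props[OF P]
  have "n = (\<Sum>C\<in>P. card C)"
    using card_Union_disjoint[of P] props by (simp add: disjoint_def pairwise_def disjnt_def)
  also have "\<dots> = card ?B + (\<Sum>C\<in>P - {?B}. card C)"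
    using props(3) B(1) by (rule sum.remove)
  finally have "n = card ?B + (\<Sum>C\<in>P - {?B}. card C)" .
  moreover have "0 < card C" if "C \<in> P" for C
    using props that by (simp add: card_gt_0_iff)
  ultimately show ?thesis
    using B(1) props(3) by (force simp: types_def part_type_def sum_unfold_sum_mset)
qed

text \<open>\<open>sim_part\<close> compares all block sizes together with the size of the block of
  n; cancelling that size from both multisets leaves the other blocks.\<close>

lemma sim_part_iff:
  assumes "P \<in> setparts n" "Q \<in> setparts n" "1 \<le> n"
  shows "sim_part n P Q \<longleftrightarrow> part_type n P = part_type n Q"
proof -
  have *: "image_mset card (mset_set R) = add_mset (snd (part_type n R)) (fst (part_type n R))"
    if R: "R \<in> setparts n" for R
  proof -
    have "mset_set R = add_mset (block_of R n) (mset_set (R - {block_of R n}))"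
      using block_of_props(1)[OF R, of n] setparts_props(3)[OF R] assms(3) mset_set.remove[of R] by auto
    then show ?thesis by (simp add: part_type_def)
  qed
  show ?thesis
    unfolding sim_part_def *[OF assms(1)] *[OF assms(2)]
    by (auto simp: part_type_def)
qed

section \<open>Existence of e-expansions\<close>

inductive_set lspan :: "('x \<Rightarrow> real) set \<Rightarrow> ('x \<Rightarrow> real) set" for S where
  zero: "(\<lambda>_. 0) \<in> lspan S"
| step: "f \<in> lspan S \<Longrightarrow> g \<in> S \<Longrightarrow> (\<lambda>w. f w + c * g w) \<in> lspan S"

lemma lspan_base: "g \<in> S \<Longrightarrow> g \<in> lspan S"
  using lspan.step[OF lspan.zero, of g S 1] by simp

lemma lspan_add:
  assumes "f \<in> lspan S" "g \<in> lspan S"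
  shows "(\<lambda>w. f w + g w) \<in> lspan S"
  using assms(2)
proof induction
  case (step g h c)
  then show ?case using lspan.step[OF step.IH step.hyps(2), of c] by (simp add: add.assoc)
qed (use assms in simp)

lemma lspan_scale:
  assumes "f \<in> lspan S"
  shows "(\<lambda>w. c * f w) \<in> lspan S"
  using assms
proof induction
  case zero
  then show ?case by (simp add: lspan.zero)
next
  case (step f g a)
  then show ?case using lspan.step[OF step.IH step.hyps(2), of "c * a"] by (simp add: algebra_simps)
qed

lemma lspan_sum:
  assumes "finite I" "\<And>i. i \<in> I \<Longrightarrow> f i \<in> lspan S"
  shows "(\<lambda>w. \<Sum>i\<in>I. f i w) \<in> lspan S"
  using assms by (induction I rule: finite_induct) (auto intro: lspan.zero lspan_add)

lemma lspan_map:
  assumes "f \<in> lspan S" "\<And>g. g \<in> S \<Longrightarrow> (\<lambda>w. q w * g (p w)) \<in> lspan T"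
  shows "(\<lambda>w. q w * f (p w)) \<in> lspan T"
  using assms(1)
proof induction
  case zero
  then show ?case by (simp add: lspan.zero)
next
  case (step f g c)
  have "(\<lambda>w. q w * f (p w) + c * (q w * g (p w))) \<in> lspan T"
    by (intro lspan_add step.IH lspan_scale assms(2) step.hyps)
  then show ?case by (simp add: algebra_simps)
qed

lemma lspan_trans:
  assumes "f \<in> lspan S" "S \<subseteq> lspan T"
  shows "f \<in> lspan T"
  using lspan_map[OF assms(1), of "\<lambda>_. 1" "\<lambda>w. w" T] assms(2) by auto

definition const_on :: "('b \<Rightarrow> 'c) \<Rightarrow> 'b set \<Rightarrow> bool" where
  "const_on v B \<longleftrightarrow> (\<forall>i\<in>B. \<forall>j\<in>B. v i = v j)"

text \<open>The power sum function of a set partition, as an indicator.\<close>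

definition const_parts :: "'b set set \<Rightarrow> ('b \<Rightarrow> 'c) \<Rightarrow> real" where
  "const_parts P v = of_bool (\<forall>B\<in>P. const_on v B)"

lemma const_on_insert:
  assumes "b \<in> C"
  shows "const_on v (insert c C) \<longleftrightarrow> v c = v b \<and> const_on v C"
proof (intro iffI conjI)
  assume *: "v c = v b \<and> const_on v C"
  have **: "v i = v b" if "i \<in> insert c C" for i
    using that
  proof (rule insertE)
    assume "i \<in> C"
    then show ?thesis using * assms unfolding const_on_def by blast
  next
    assume "i = c"
    then show ?thesis using * by blast
  qed
  show "const_on v (insert c C)"
    unfolding const_on_def by (intro ballI) (simp only: **)
next
  assume *: "const_on v (insert c C)"
  show "v c = v b" using * assms unfolding const_on_def by blast
  show "const_on v C" using * unfolding const_on_def by blast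
qed

text \<open>If v is injective on B, then v c agrees with v b for at most one b in B, so the sum is
  itself an indicator.\<close>

lemma inj_indicator_insert:
  assumes "finite B" "c \<notin> B"
  shows "of_bool (inj_on v (insert c B)) =
    of_bool (inj_on v B) * (1 - (\<Sum>b\<in>B. of_bool (v c = v b)) :: real)"
proof (cases "inj_on v B")
  case True
  show ?thesis
  proof (cases "v c \<in> v ` B")
    case True
    then obtain b where b: "b \<in> B" "v c = v b" by auto
    have "v c = v b' \<longleftrightarrow> b' = b" if "b' \<in> B" for b'
      using b that \<open>inj_on v B\<close> by (auto simp: inj_on_def)
    then have "(\<Sum>b\<in>B. of_bool (v c = v b)) = (\<Sum>b'\<in>B. if b' = b then 1 else 0 :: real)"
      by (intro sum.cong) auto
    then show ?thesis using True b assms by (simp add: inj_on_insert)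
  next
    case False
    then have "(\<Sum>b\<in>B. of_bool (v c = v b)) = (0 :: real)"
      by (intro sum.neutral) auto
    then show ?thesis using False True assms(2) by (simp add: inj_on_insert)
  qed
qed (simp add: inj_on_insert)

lemma part_add_to_block:
  assumes "finite B" "c \<notin> B" and T: "partition_on B T" and C: "C \<in> T" "b \<in> C"
  shows "partition_on (insert c B) (insert (insert c C) (T - {C}))"
    and "of_bool (v c = v b) * const_parts T v = const_parts (insert (insert c C) (T - {C})) v"
proof -
  have dj: "\<And>X Y. X \<in> T \<Longrightarrow> Y \<in> T \<Longrightarrow> X \<noteq> Y \<Longrightarrow> X \<inter> Y = {}" and U: "\<Union>T = B" and ne: "{} \<notin> T"
    using T by (auto simp: partition_on_def disjoint_def)
  show "partition_on (insert c B) (insert (insert c C) (T - {C}))"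
  proof (rule partition_onI)
    show "\<Union>(insert (insert c C) (T - {C})) = insert c B" using U C by auto
    show "{} \<notin> insert (insert c C) (T - {C})" using ne by auto
  next
    fix X Y assume XY: "X \<in> insert (insert c C) (T - {C})" "Y \<in> insert (insert c C) (T - {C})" "X \<noteq> Y"
    have "insert c C \<inter> Z = {}" if "Z \<in> T - {C}" for Z
      using dj[of C Z] that C U assms(2) by auto
    moreover have "X \<inter> Y = {}" if "X \<in> T" "Y \<in> T" using dj that XY(3) by blast
    ultimately show "disjnt X Y" using XY unfolding disjnt_def by blast
  qed
  have "const_on v (insert c C) \<longleftrightarrow> v c = v b \<and> const_on v C"
    using C(2) by (rule const_on_insert)
  then have "(v c = v b \<and> (\<forall>B\<in>T. const_on v B)) \<longleftrightarrow> (\<forall>B\<in>insert (insert c C) (T - {C}). const_on v B)"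
    using C(1) by blast
  then show "of_bool (v c = v b) * const_parts T v = const_parts (insert (insert c C) (T - {C})) v"
    unfolding const_parts_def of_bool_conj[symmetric] by (rule arg_cong)
qed

text \<open>The construction gives k = (-1)^(|B|-1) (|B|-1)!, the Moebius value of the partition
  lattice. Being nonzero, it allows solving for the indicator of constancy, up to strictly finer
  partitions.\<close>

lemma inj_indicator_expand:
  assumes "finite B" "B \<noteq> {}"
  shows "\<exists>k h. k \<noteq> 0 \<and> h \<in> lspan (const_parts ` {T. partition_on B T \<and> T \<noteq> {B}}) \<and>
    (\<forall>v :: 'b \<Rightarrow> 'c. of_bool (inj_on v B) = k * of_bool (const_on v B) + h v)"
  using assms
proof (induction B rule: finite_ne_induct)
  case (singleton x)
  show ?case
    by (intro exI[of _ 1] exI[of _ "\<lambda>_. 0"]) (auto simp: const_on_def lspan.zero)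
next
  case (insert c B)
  let ?S = "\<lambda>B. const_parts ` {T. partition_on B T \<and> T \<noteq> {B}} :: (('b \<Rightarrow> 'c) \<Rightarrow> real) set"
  let ?B = "insert c B"
  obtain k h where k: "k \<noteq> 0" and h: "h \<in> lspan (?S B)"
    and eq: "\<And>v :: 'b \<Rightarrow> 'c. of_bool (inj_on v B) = k * of_bool (const_on v B) + h v"
    using insert.IH by blast
  have B: "B \<noteq> {}" "c \<notin> B" "finite B" using insert.hyps by auto
  have sep: "const_parts (insert {c} T) \<in> ?S ?B" if T: "partition_on B T" for T
  proof -
    have "partition_on ?B (insert {c} T)"
    proof (rule partition_onI)
      show "\<Union>(insert {c} T) = ?B" using T by (auto simp: partition_on_def)
      show "{} \<notin> insert {c} T" using T by (auto simp: partition_on_def)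
      show "disjnt X Y" if "X \<in> insert {c} T" "Y \<in> insert {c} T" "X \<noteq> Y" for X Y
      proof (cases "X \<in> T \<and> Y \<in> T")
        case True
        then show ?thesis using T that(3) disjointD[of T X Y] by (simp add: partition_on_def disjnt_def)
      next
        case False
        then show ?thesis using T that B(2) by (auto simp: partition_on_def disjnt_def)
      qed
    qed
    moreover have "insert {c} T \<noteq> {?B}"
    proof
      assume "insert {c} T = {?B}"
      then have "{c} = ?B" by blast
      then show False using B by blast
    qed
    ultimately show ?thesis by blast
  qed
  have sep_eq: "const_parts (insert {c} T) = (const_parts T :: ('b \<Rightarrow> 'c) \<Rightarrow> real)" for T
    by (rule ext) (simp add: const_parts_def const_on_def)
  have sep': "const_parts T \<in> lspan (?S ?B)" if "partition_on B T" for T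
    using lspan_base[OF sep[OF that]] unfolding sep_eq .
  have triv: "partition_on B {B}" using B by (simp add: partition_on_def)
  have cB: "const_parts {B} v = of_bool (const_on v B)" for v :: "'b \<Rightarrow> 'c"
    by (simp add: const_parts_def)
  have hS: "h \<in> lspan (?S ?B)"
  proof (rule lspan_trans[OF h], rule subsetI)
    fix g assume "g \<in> ?S B"
    then show "g \<in> lspan (?S ?B)" using sep' by blast
  qed
  have cS: "(\<lambda>v. of_bool (const_on v B)) \<in> lspan (?S ?B)"
    using sep'[OF triv] unfolding cB[abs_def] .
  have hb: "(\<lambda>v. of_bool (v c = v b) * h v) \<in> lspan (?S ?B)" if b: "b \<in> B" for b
  proof (rule lspan_map[OF h, of _ "\<lambda>v. v"])
    fix g assume "g \<in> ?S B"
    then obtain T where T: "partition_on B T" "T \<noteq> {B}" "g = const_parts T" by auto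
    obtain C where C: "C \<in> T" "b \<in> C" using T(1) b by (auto simp: partition_on_def)
    \<comment> \<open>Adding c to a block of a partition other than {B} never yields the one-block
      partition, so these terms stay in the remainder.\<close>
    have "insert (insert c C) (T - {C}) \<noteq> {?B}"
    proof
      assume *: "insert (insert c C) (T - {C}) = {?B}"
      then have "insert c C = insert c B" by auto
      moreover have "C \<subseteq> B" using T(1) C(1) by (auto simp: partition_on_def)
      ultimately have "C = B" using B(2) insert_ident[of c C B] by blast
      moreover have "T - {C} = {}"
      proof (rule equals0I)
        fix X assume X: "X \<in> T - {C}"
        then have "X = ?B" using * by auto
        then show False using X T(1) B(2) by (auto simp: partition_on_def)
      qed
      ultimately show False using T(2) C(1) by auto
    qed
    then show "(\<lambda>v. of_bool (v c = v b) * g v) \<in> lspan (?S ?B)"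
      using part_add_to_block[OF B(3,2) T(1) C] unfolding T(3)
      by (intro lspan_base) (auto simp: fun_eq_iff)
  qed
  have cb: "of_bool (v c = v b) * of_bool (const_on v B) = (of_bool (const_on v ?B) :: real)"
    if "b \<in> B" for b and v :: "'b \<Rightarrow> 'c"
    using const_on_insert[OF that, of v c] by simp
  \<comment> \<open>Only the product of k times the constancy indicator of B with the sum over b
    yields constancy on all of \<open>?B\<close>. Constancy on B alone belongs to the partition with
    c as a singleton.\<close>
  let ?h = "\<lambda>v. (k * of_bool (const_on v B) + h v) + (-1) * (\<Sum>b\<in>B. of_bool (v c = v b) * h v)"
  have "?h \<in> lspan (?S ?B)"
    by (intro lspan_add lspan_scale lspan_sum hS cS hb B)
  moreover have "of_bool (inj_on v ?B) = (- k * real (card B)) * of_bool (const_on v ?B) + ?h v"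
    for v :: "'b \<Rightarrow> 'c"
  proof -
    have "of_bool (inj_on v ?B) = (k * of_bool (const_on v B) + h v) * (1 - (\<Sum>b\<in>B. of_bool (v c = v b)) :: real)"
      unfolding inj_indicator_insert[OF B(3,2)] eq ..
    also have "\<dots> = k * of_bool (const_on v B) + h v
        - k * (\<Sum>b\<in>B. of_bool (v c = v b) * of_bool (const_on v B)) - (\<Sum>b\<in>B. of_bool (v c = v b) * h v)"
      by (simp add: algebra_simps sum_distrib_left sum.distrib)
    also have "(\<Sum>b\<in>B. of_bool (v c = v b) * of_bool (const_on v B)) = real (card B) * of_bool (const_on v ?B)"
      using cb by simp
    finally show ?thesis by simp
  qed
  moreover have "- k * real (card B) \<noteq> 0" using k B by simp
  ultimately show ?case by (intro exI conjI allI)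
qed

section \<open>Trading constant blocks for injective blocks\<close>

definition letter_at :: "nat list \<Rightarrow> nat \<Rightarrow> nat" where
  "letter_at w j = w ! (j - 1)"

text \<open>Interpolates between power sum functions (Q empty) and the e_pi (P empty).\<close>

definition mixed :: "nat \<Rightarrow> nat set set \<Rightarrow> nat set set \<Rightarrow> nat list \<Rightarrow> real" where
  "mixed n P Q w = of_bool (is_word n w \<and> (\<forall>B\<in>P. const_on (letter_at w) B) \<and> (\<forall>B\<in>Q. inj_on (letter_at w) B))"

text \<open>Constant blocks are traded for injective ones; refining a constant block increases the
  number of blocks, which bounds the recursion.\<close>

lemma mixed_in_span:
  assumes "partition_on {1..n} (P \<union> Q)" "P \<inter> Q = {}"
  shows "mixed n P Q \<in> lspan (e_pi n ` setparts n)"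
  using assms
proof (induction "(n + 1) * (n - card (P \<union> Q)) + card P" arbitrary: P Q rule: less_induct)
  case less
  have fin: "finite (P \<union> Q)" using less.prems(1) finite_elements by blast
  have bound: "card R \<le> n" if "partition_on {1..n} R" for R
  proof -
    have R: "R \<in> setparts n" using that by (simp add: setparts_def)
    have "card R = (\<Sum>B\<in>R. 1)" by simp
    also have "\<dots> \<le> (\<Sum>B\<in>R. card B)"
      using setparts_props[OF R] by (intro sum_mono) (simp add: Suc_le_eq card_gt_0_iff)
    also have "\<dots> = card (\<Union>R)"
      using setparts_props[OF R] by (intro card_Union_disjoint[symmetric]) auto
    finally show ?thesis using setparts_props(1)[OF R] by simp
  qed
  show ?case
  proof (cases "P = {}")
    case True
    have "mixed n P Q = e_pi n Q"
      by (auto simp: fun_eq_iff mixed_def e_pi_def True inj_on_def letter_at_def)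
    then show ?thesis using less.prems True by (auto intro: lspan_base simp: setparts_def)
  next
    case False
    then obtain B where B: "B \<in> P" by blast
    define R where "R = P - {B}"
    have P: "P = insert B R" "B \<notin> R" "B \<notin> Q" using B less.prems(2) by (auto simp: R_def)
    have "P \<union> Q \<in> setparts n" using less.prems(1) by (simp add: setparts_def)
    then have finB: "finite B" "B \<noteq> {}" using setparts_props(4,5)[of "P \<union> Q" n B] B by auto
    obtain k h where k: "k \<noteq> 0"
      and h: "h \<in> lspan (const_parts ` {T. partition_on B T \<and> T \<noteq> {B}})"
      and eq: "\<And>v :: nat \<Rightarrow> nat. of_bool (inj_on v B) = k * of_bool (const_on v B) + h v"
      using inj_indicator_expand[OF finB, where 'c = nat] by blast
    have 1: "mixed n R (insert B Q) \<in> lspan (e_pi n ` setparts n)"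
    proof (rule less.hyps)
      have "R \<union> insert B Q = P \<union> Q" using P by auto
      moreover have "card R < card P" using P fin by simp
      ultimately show "(n + 1) * (n - card (R \<union> insert B Q)) + card R < (n + 1) * (n - card (P \<union> Q)) + card P"
        by simp
      show "partition_on {1..n} (R \<union> insert B Q)" using \<open>R \<union> insert B Q = P \<union> Q\<close> less.prems(1) by simp
      show "R \<inter> insert B Q = {}" using P less.prems(2) by auto
    qed
    have 2: "(\<lambda>w. mixed n R Q w * h (letter_at w)) \<in> lspan (e_pi n ` setparts n)"
    proof (rule lspan_map[OF h])
      fix g :: "(nat \<Rightarrow> nat) \<Rightarrow> real"
      assume "g \<in> const_parts ` {T. partition_on B T \<and> T \<noteq> {B}}"
      then obtain T where T: "partition_on B T" "T \<noteq> {B}" "g = const_parts T" by auto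
      have UT: "\<Union>T = B" and djT: "\<And>X Y. X \<in> T \<Longrightarrow> Y \<in> T \<Longrightarrow> X \<noteq> Y \<Longrightarrow> X \<inter> Y = {}" and neT: "{} \<notin> T"
        using T(1) by (auto simp: partition_on_def disjoint_def)
      have djP: "\<And>X Y. X \<in> P \<union> Q \<Longrightarrow> Y \<in> P \<union> Q \<Longrightarrow> X \<noteq> Y \<Longrightarrow> X \<inter> Y = {}"
        and UP: "\<Union>(P \<union> Q) = {1..n}" and neP: "{} \<notin> P \<union> Q"
        using less.prems(1) by (auto simp: partition_on_def disjoint_def)
      have cross: "X \<inter> Y = {}" if "X \<in> T" "Y \<in> R \<union> Q" for X Y
      proof -
        have "Y \<inter> B = {}" using djP[of Y B] that P by auto
        then show ?thesis using that UT by blast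
      qed
      have new: "partition_on {1..n} ((R \<union> T) \<union> Q)"
      proof (rule partition_onI)
        show "\<Union>(R \<union> T \<union> Q) = {1..n}" using UP UT P by auto
        show "{} \<notin> R \<union> T \<union> Q" using neT neP P by auto
        show "disjnt X Y" if XY: "X \<in> R \<union> T \<union> Q" "Y \<in> R \<union> T \<union> Q" "X \<noteq> Y" for X Y
        proof -
          consider "X \<in> T" "Y \<in> T" | "X \<in> T" "Y \<in> R \<union> Q" | "Y \<in> T" "X \<in> R \<union> Q" | "X \<in> R \<union> Q" "Y \<in> R \<union> Q"
            using XY by blast
          then show ?thesis
          proof cases
            case 1
            then show ?thesis using djT XY(3) by (simp add: disjnt_def)
          next
            case 2
            then show ?thesis using cross by (simp add: disjnt_def)
          next
            case 3
            then show ?thesis using cross[of Y X] by (auto simp: disjnt_def)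
          next
            case 4
            then show ?thesis using djP[of X Y] XY(3) P by (auto simp: disjnt_def)
          qed
        qed
      qed
      have djRTQ: "(R \<union> Q) \<inter> T = {}" using cross neT by fastforce
      have finT: "finite T" using T(1) finB(1) finite_elements by blast
      have cT: "2 \<le> card T"
      proof (rule ccontr)
        assume "\<not> 2 \<le> card T"
        then have "card T = 0 \<or> card T = 1" by linarith
        then show False
        proof
          assume "card T = 0"
          then show False using finT UT finB(2) by simp
        next
          assume "card T = 1"
          then obtain X where "T = {X}" by (auto simp: card_1_singleton_iff)
          then show False using UT T(2) by simp
        qed
      qed
      have "card (P \<union> Q) = Suc (card (R \<union> Q))" using P fin by simp
      moreover have "card ((R \<union> T) \<union> Q) = card (R \<union> Q) + card T"
      proof -
        have "(R \<union> T) \<union> Q = (R \<union> Q) \<union> T" by auto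
        then show ?thesis using djRTQ fin finT P by (simp add: card_Un_disjoint)
      qed
      ultimately have lt: "card (P \<union> Q) < card ((R \<union> T) \<union> Q)" using cT by simp
      have "mixed n (R \<union> T) Q \<in> lspan (e_pi n ` setparts n)"
      proof (rule less.hyps)
        have cRT: "card (R \<union> T) \<le> n"
          using bound[OF new] card_mono[of "(R \<union> T) \<union> Q" "R \<union> T"] fin finT P by auto
        \<comment> \<open>Splitting B may raise the number of constant blocks, but it stays at most
          n; the factor n + 1 in the measure makes the gain in blocks outweigh it.\<close>
        obtain d where d: "n - card (P \<union> Q) = Suc d" "n - card ((R \<union> T) \<union> Q) \<le> d"
          using lt bound[OF new] by (intro that[of "n - card (P \<union> Q) - 1"]) auto
        have "(n + 1) * (n - card ((R \<union> T) \<union> Q)) + card (R \<union> T) \<le> (n + 1) * d + n"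
          by (intro add_mono mult_le_mono2 d(2) cRT)
        also have "\<dots> < (n + 1) * Suc d + card P" by simp
        finally show "(n + 1) * (n - card ((R \<union> T) \<union> Q)) + card (R \<union> T)
            < (n + 1) * (n - card (P \<union> Q)) + card P"
          unfolding d(1) .
        show "partition_on {1..n} ((R \<union> T) \<union> Q)" by (rule new)
        show "(R \<union> T) \<inter> Q = {}" using djRTQ less.prems(2) P by auto
      qed
      moreover have "mixed n R Q w * g (letter_at w) = mixed n (R \<union> T) Q w" for w
        unfolding mixed_def T(3) const_parts_def of_bool_conj[symmetric] by (rule arg_cong[of _ _ of_bool]) blast
      ultimately show "(\<lambda>w. mixed n R Q w * g (letter_at w)) \<in> lspan (e_pi n ` setparts n)" by simp
    qed
    \<comment> \<open>The expansion of the injectivity indicator of B is solved for the constancy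
      indicator.\<close>
    have "mixed n P Q w = 1 / k * (mixed n R (insert B Q) w + (- 1) * (mixed n R Q w * h (letter_at w)))" for w
    proof -
      have "mixed n R (insert B Q) w = mixed n R Q w * of_bool (inj_on (letter_at w) B)"
        unfolding mixed_def of_bool_conj[symmetric] by (rule arg_cong[of _ _ of_bool]) blast
      moreover have "mixed n P Q w = mixed n R Q w * of_bool (const_on (letter_at w) B)"
        unfolding mixed_def P(1) of_bool_conj[symmetric] by (rule arg_cong[of _ _ of_bool]) blast
      ultimately show ?thesis using k unfolding eq by (simp add: field_simps)
    qed
    then have "mixed n P Q = (\<lambda>w. 1 / k * (mixed n R (insert B Q) w + (- 1) * (mixed n R Q w * h (letter_at w))))"
      by blast
    then show ?thesis by (simp only:) (intro lspan_scale lspan_add 1 2)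
  qed
qed

lemma merge_blocks:
  assumes P: "P \<in> setparts n" and i: "i \<in> {1..n}" and j: "j \<in> {1..n}"
  shows "\<exists>Q\<in>setparts n. \<forall>w. of_bool (letter_at w i = letter_at w j) * mixed n P {} w = mixed n Q {} w"
proof -
  let ?X = "block_of P i" and ?Y = "block_of P j"
  \<comment> \<open>If i and j lie in the same block, this is P again.\<close>
  let ?Q = "insert (?X \<union> ?Y) (P - {?X, ?Y})"
  note p = setparts_props[OF P]
  have X: "?X \<in> P" "i \<in> ?X" and Y: "?Y \<in> P" "j \<in> ?Y"
    using block_of_props[OF P i] block_of_props[OF P j] by auto
  have dj: "\<And>A B. A \<in> P \<Longrightarrow> B \<in> P \<Longrightarrow> A \<noteq> B \<Longrightarrow> A \<inter> B = {}" using p(2) by (auto simp: disjoint_def)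
  have "partition_on {1..n} ?Q"
  proof (rule partition_onI)
    show "\<Union>?Q = {1..n}" using p(1) X Y by auto
    show "{} \<notin> ?Q" using p(5) X by auto
    show "disjnt A B" if AB: "A \<in> ?Q" "B \<in> ?Q" "A \<noteq> B" for A B
    proof -
      have "(?X \<union> ?Y) \<inter> C = {}" if "C \<in> P - {?X, ?Y}" for C
        using dj[of ?X C] dj[of ?Y C] X Y that by auto
      then show ?thesis using AB dj[of A B] unfolding disjnt_def by blast
    qed
  qed
  moreover have "letter_at w i = letter_at w j \<and> (\<forall>B\<in>P. const_on (letter_at w) B) \<longleftrightarrow>
      (\<forall>B\<in>?Q. const_on (letter_at w) B)" for w
  proof -
    have "const_on (letter_at w) (?X \<union> ?Y) \<longleftrightarrow>
        letter_at w i = letter_at w j \<and> const_on (letter_at w) ?X \<and> const_on (letter_at w) ?Y"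
      using X(2) Y(2) unfolding const_on_def by (metis UnE UnI1 UnI2)
    then show ?thesis using X(1) Y(1) by blast
  qed
  then have "of_bool (letter_at w i = letter_at w j) * mixed n P {} w = mixed n ?Q {} w" for w
    unfolding mixed_def of_bool_conj[symmetric] by (intro arg_cong[of _ _ of_bool]) blast
  ultimately show ?thesis by (auto simp: setparts_def)
qed

text \<open>Each edge contributes a factor 1 minus the indicator of equal letters, and by
  \<open>merge_blocks\<close> multiplying with that indicator preserves the generating set.\<close>

lemma edge_product_in_span:
  assumes "finite R" "R \<subseteq> {1..n} \<times> {1..n}"
  shows "(\<lambda>w. of_bool (is_word n w \<and> (\<forall>(i, j)\<in>R. letter_at w i \<noteq> letter_at w j)))
    \<in> lspan ((\<lambda>P. mixed n P {}) ` setparts n)" (is "?f R \<in> ?L")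
  using assms
proof (induction R rule: finite_induct)
  case empty
  let ?P = "(\<lambda>i. {i}) ` {1..n}"
  have "?P \<in> setparts n" by (auto simp: setparts_def partition_on_def disjoint_def)
  moreover have "?f {} = mixed n ?P {}"
    by (auto simp: mixed_def const_on_def)
  ultimately show ?case by (auto intro: lspan_base)
next
  case (insert e R)
  obtain i j where e: "e = (i, j)" by (cases e)
  have ij: "i \<in> {1..n}" "j \<in> {1..n}" using insert.prems e by auto
  have IH: "?f R \<in> ?L" using insert by auto
  have "(\<lambda>w. of_bool (letter_at w i = letter_at w j) * ?f R w) \<in> ?L"
  proof (rule lspan_map[OF IH, of _ "\<lambda>w. w"])
    fix g assume "g \<in> (\<lambda>P. mixed n P {}) ` setparts n"
    then obtain P where P: "P \<in> setparts n" "g = mixed n P {}" by auto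
    obtain Q where "Q \<in> setparts n"
      "\<And>w. of_bool (letter_at w i = letter_at w j) * mixed n P {} w = mixed n Q {} w"
      using merge_blocks[OF P(1) ij] by blast
    then show "(\<lambda>w. of_bool (letter_at w i = letter_at w j) * g w) \<in> ?L"
      unfolding P(2) by (auto intro: lspan_base)
  qed
  then have "(\<lambda>w. ?f R w + (- 1) * (of_bool (letter_at w i = letter_at w j) * ?f R w)) \<in> ?L"
    by (intro lspan_add IH lspan_scale)
  moreover have "?f R w + (- 1) * (of_bool (letter_at w i = letter_at w j) * ?f R w) = ?f (insert e R) w" for w
    by (auto simp: e)
  ultimately show ?case by simp
qed

lemma finite_setparts: "finite (setparts n)"
  unfolding setparts_def by (rule finitely_many_partition_on) simp

lemma lspan_e_expansion:
  assumes "f \<in> lspan (e_pi n ` setparts n)"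
  shows "\<exists>c. e_expansion n f c"
  using assms
proof induction
  case zero
  show ?case by (rule exI[of _ "\<lambda>_. 0"]) (simp add: e_expansion_def)
next
  case (step f g a)
  then obtain c P where c: "e_expansion n f c" and P: "P \<in> setparts n" "g = e_pi n P" by auto
  have "(\<Sum>Q\<in>setparts n. (c Q + (if Q = P then a else 0)) * e_pi n Q w) = f w + a * g w" for w
  proof -
    have "(\<Sum>Q\<in>setparts n. (c Q + (if Q = P then a else 0)) * e_pi n Q w) =
        (\<Sum>Q\<in>setparts n. c Q * e_pi n Q w) + (\<Sum>Q\<in>setparts n. if Q = P then a * e_pi n P w else 0)"
      unfolding sum.distrib[symmetric] by (intro sum.cong) (auto simp: algebra_simps)
    then show ?thesis using c P finite_setparts by (simp add: e_expansion_def)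
  qed
  then show ?case
    by (intro exI[of _ "\<lambda>Q. c Q + (if Q = P then a else 0)"]) (simp add: e_expansion_def)
qed

theorem Y_G_e_expansion: "\<exists>c. e_expansion n (Y_G n G) c"
proof (rule lspan_e_expansion)
  let ?R = "{(i, j) \<in> {1..n} \<times> {1..n}. G i j}"
  have "proper_word n G w \<longleftrightarrow> (\<forall>(i, j)\<in>?R. letter_at w i \<noteq> letter_at w j)" for w
    unfolding proper_word_def letter_at_def by blast
  then have "Y_G n G = (\<lambda>w. of_bool (is_word n w \<and> (\<forall>(i, j)\<in>?R. letter_at w i \<noteq> letter_at w j)))"
    by (simp add: fun_eq_iff Y_G_def)
  also have "\<dots> \<in> lspan ((\<lambda>P. mixed n P {}) ` setparts n)"
    by (rule edge_product_in_span) (auto intro: finite_subset[of _ "{1..n} \<times> {1..n}"])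
  finally show "Y_G n G \<in> lspan (e_pi n ` setparts n)"
    by (rule lspan_trans) (use mixed_in_span[where Q = "{}"] in \<open>auto simp: setparts_def\<close>)
qed

section \<open>Comparison of coefficients\<close>

definition type_mset :: "nat multiset \<times> nat \<Rightarrow> nat multiset" where
  "type_mset \<theta> = add_mset (snd \<theta>) (fst \<theta>)"

definition type_list :: "nat multiset \<times> nat \<Rightarrow> nat list" where
  "type_list \<theta> = rev (sorted_list_of_multiset (type_mset \<theta>))"

lemma mset_type_list [simp]: "mset (type_list \<theta>) = type_mset \<theta>"
  by (simp add: type_list_def)

lemma int_partition_type_list:
  assumes "\<theta> \<in> types n"
  shows "int_partition n (type_list \<theta>)"
proof -
  have "sum_list (type_list \<theta>) = sum_mset (type_mset \<theta>)"
    by (metis mset_type_list sum_mset_sum_list)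
  moreover have "set (type_list \<theta>) = set_mset (type_mset \<theta>)"
    by (metis mset_type_list set_mset_mset)
  moreover have "sorted_wrt (\<ge>) (type_list \<theta>)"
    by (simp add: type_list_def sorted_wrt_rev)
  ultimately show ?thesis
    using assms by (auto simp: int_partition_def types_def type_mset_def)
qed

lemma finite_int_partitions: "finite {l. int_partition n l}"
proof (rule finite_subset)
  show "{l. int_partition n l} \<subseteq> {xs. set xs \<subseteq> {..n} \<and> length xs \<le> n}"
  proof safe
    fix l x assume l: "int_partition n l"
    then show "x \<le> n" if "x \<in> set l"
      using member_le_sum_list[of x l] that by (auto simp: int_partition_def)
    show "length l \<le> n"
      using l size_le_sum_mset[of "mset l"] by (auto simp: int_partition_def sum_mset_sum_list)
  qed
qed (rule finite_lists_length_le, simp)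

text \<open>In the monoid algebra of multisets, the weight of a word is its commutative monomial, so
  identities for weighted word sums can be read off coefficientwise.\<close>

abbreviation monomial_weight :: "nat \<Rightarrow> nat multiset \<Rightarrow>\<^sub>0 int" where
  "monomial_weight a \<equiv> Poly_Mapping.single {#a#} 1"

lemma prod_list_monomial_weight: "prod_list (map monomial_weight w) = Poly_Mapping.single (mset w) 1"
  by (induction w) (simp_all add: mult_single)

lemma prod_monomial_weight:
  "finite S \<Longrightarrow> (\<Prod>a\<in>S. monomial_weight a) = Poly_Mapping.single (mset_set S) 1"
  by (induction S rule: finite_induct) (simp_all add: mult_single)

lemma lookup_sum_single:
  assumes "finite S"
  shows "Poly_Mapping.lookup (\<Sum>s\<in>S. Poly_Mapping.single (f s) (1 :: int)) m = int (card {s \<in> S. f s = m})"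
proof -
  have "Poly_Mapping.lookup (\<Sum>s\<in>S. Poly_Mapping.single (f s) (1 :: int)) m = (\<Sum>s\<in>S. if f s = m then 1 else 0)"
    by (auto simp: lookup_sum lookup_single when_def intro!: sum.cong)
  then show ?thesis using assms by (simp add: sum.If_cases Int_def)
qed

lemma lookup_of_nat_mult: "Poly_Mapping.lookup (of_nat k * f :: nat multiset \<Rightarrow>\<^sub>0 int) m = int k * Poly_Mapping.lookup f m"
  by (induction k) (simp_all add: lookup_add algebra_simps)

lemma of_nat_prod_mset: "of_nat (\<Prod>l\<in>#L. f l) = (\<Prod>l\<in>#L. of_nat (f l) :: 'a :: comm_semiring_1)"
  by (induction L) simp_all

lemma prod_list_esym_monomial:
  fixes A :: "nat set" and l :: "nat list"
  defines "T \<equiv> \<lambda>l. {Ss. list_all2 (\<lambda>S k. S \<subseteq> A \<and> card S = k) Ss l}"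
  assumes A: "finite A"
  shows "finite (T l) \<and> prod_list (map (esym A monomial_weight) l) =
    (\<Sum>Ss\<in>T l. Poly_Mapping.single (sum_list (map mset_set Ss)) 1)"
proof (induction l)
  case Nil
  then show ?case by (simp add: T_def)
next
  case (Cons k l)
  let ?U = "{S. S \<subseteq> A \<and> card S = k}"
  have T: "T (k # l) = (\<lambda>(S, Ss). S # Ss) ` (?U \<times> T l)"
    unfolding T_def list_all2_Cons2 by auto
  have finU: "finite ?U" using A by (auto intro: finite_subset[of _ "Pow A"])
  have inj: "inj_on (\<lambda>(S, Ss). S # Ss) (?U \<times> T l)" by (auto intro: inj_onI)
  have "esym A monomial_weight k = (\<Sum>S\<in>?U. Poly_Mapping.single (mset_set S) 1)"
    unfolding esym_def by (intro sum.cong refl prod_monomial_weight) (use A in \<open>auto intro: finite_subset\<close>)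
  then have "prod_list (map (esym A monomial_weight) (k # l)) =
      (\<Sum>S\<in>?U. Poly_Mapping.single (mset_set S) 1) *
      (\<Sum>Ss\<in>T l. Poly_Mapping.single (sum_list (map mset_set Ss)) 1)"
    using Cons.IH by simp
  also have "\<dots> = (\<Sum>(S, Ss)\<in>?U \<times> T l. Poly_Mapping.single (mset_set S + sum_list (map mset_set Ss)) 1)"
    by (simp add: sum_product sum.cartesian_product mult_single)
  also have "\<dots> = (\<Sum>Ss\<in>T (k # l). Poly_Mapping.single (sum_list (map mset_set Ss)) 1)"
    unfolding T sum.reindex[OF inj] by (simp add: case_prod_unfold)
  finally show ?case using finU Cons.IH unfolding T by simp
qed

text \<open>Sets whose monomials multiply to m consist of letters of m, so the finite alphabet of
  its nonzero letters captures every tuple counted by \<open>e_lambda\<close>.\<close>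

lemma lookup_prod_list_esym:
  fixes m :: "nat multiset"
  defines "A \<equiv> set_mset m - {0}"
  shows "real_of_int (Poly_Mapping.lookup (prod_list (map (esym A monomial_weight) l)) m) = e_lambda l m"
proof -
  have A: "finite A" by (simp add: A_def)
  let ?T = "{Ss. list_all2 (\<lambda>S k. S \<subseteq> A \<and> card S = k) Ss l}"
  have "{Ss \<in> ?T. sum_list (map mset_set Ss) = m} = {Ss :: nat set list. length Ss = length l \<and>
      (\<forall>i<length l. finite (Ss ! i) \<and> card (Ss ! i) = l ! i \<and> 0 \<notin> Ss ! i) \<and>
      sum_list (map mset_set Ss) = m}"
  proof (intro equalityI subsetI)
    fix Ss assume "Ss \<in> {Ss \<in> ?T. sum_list (map mset_set Ss) = m}"
    then have Ss: "length Ss = length l" "sum_list (map mset_set Ss) = m"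
      and sub: "\<And>i. i < length l \<Longrightarrow> Ss ! i \<subseteq> A \<and> card (Ss ! i) = l ! i"
      by (simp_all add: list_all2_conv_all_nth)
    have "finite (Ss ! i) \<and> card (Ss ! i) = l ! i \<and> 0 \<notin> Ss ! i" if "i < length l" for i
      using sub[OF that] finite_subset[of "Ss ! i" A] A unfolding A_def by blast
    then show "Ss \<in> {Ss :: nat set list. length Ss = length l \<and>
      (\<forall>i<length l. finite (Ss ! i) \<and> card (Ss ! i) = l ! i \<and> 0 \<notin> Ss ! i) \<and>
      sum_list (map mset_set Ss) = m}"
      using Ss by simp
  next
    fix Ss :: "nat set list"
    assume Ss: "Ss \<in> {Ss. length Ss = length l \<and>
      (\<forall>i<length l. finite (Ss ! i) \<and> card (Ss ! i) = l ! i \<and> 0 \<notin> Ss ! i) \<and>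
      sum_list (map mset_set Ss) = m}"
    have "Ss ! i \<subseteq> A" if i: "i < length l" for i
    proof (rule subsetI)
      fix a assume "a \<in> Ss ! i"
      have fin: "finite (Ss ! i)" "0 \<notin> Ss ! i" using Ss i by blast+
      have "a \<noteq> 0" using fin(2) \<open>a \<in> Ss ! i\<close> by metis
      moreover have "a \<in># mset_set (Ss ! i)" using fin(1) \<open>a \<in> Ss ! i\<close> by simp
      moreover have "mset_set (Ss ! i) \<in># mset (map mset_set Ss)" using Ss i by simp
      ultimately have "a \<in># sum_mset (mset (map mset_set Ss))" by (meson in_Union_mset_iff)
      then show "a \<in> A" using Ss \<open>a \<noteq> 0\<close> by (auto simp: A_def sum_mset_sum_list)
    qed
    then show "Ss \<in> {Ss \<in> ?T. sum_list (map mset_set Ss) = m}"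
      using Ss by (auto simp: list_all2_conv_all_nth)
  qed
  moreover have "finite ?T" "prod_list (map (esym A monomial_weight) l) =
      (\<Sum>Ss\<in>?T. Poly_Mapping.single (sum_list (map mset_set Ss)) 1)"
    using prod_list_esym_monomial[OF A, of l] by auto
  ultimately show ?thesis by (simp add: lookup_sum_single e_lambda_def)
qed

lemma card_block_proper:
  assumes P: "P \<in> setparts n" and n: "1 \<le> n"
  shows "real (card {w. is_word n w \<and> block_proper P w \<and> mset w = m}) =
    real (\<Prod>l\<in>#type_mset (part_type n P). fact l) * e_lambda (type_list (part_type n P)) m"
proof -
  define A where "A = set_mset m - {0}"
  have A: "finite A" by (simp add: A_def)
  let ?M = "type_mset (part_type n P)"
  have M: "image_mset card (mset_set P) = ?M"
    using block_of_props(1)[OF P, of n] setparts_props(3)[OF P] n mset_set.remove[of P]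
    by (auto simp: type_mset_def part_type_def)
  have prod: "(\<Prod>l\<in>#?M. of_nat (fact l) * esym A monomial_weight l) =
      of_nat (\<Prod>l\<in>#?M. fact l) * prod_list (map (esym A monomial_weight) (type_list (part_type n P)))"
    by (simp add: prod_mset.distrib of_nat_prod_mset del: of_nat_fact flip: mset_type_list prod_mset_prod_list)
  have "{w. is_word n w \<and> block_proper P w \<and> mset w = m} =
      {w \<in> {w. w \<in> words n A \<and> block_proper P w}. mset w = m}"
    by (auto simp: is_word_def words_def A_def)
  then have "int (card {w. is_word n w \<and> block_proper P w \<and> mset w = m}) =
      Poly_Mapping.lookup (\<Sum>w | w \<in> words n A \<and> block_proper P w. prod_list (map monomial_weight w)) m"
    unfolding prod_list_monomial_weight
    by (subst lookup_sum_single) (simp_all add: finite_words[OF A])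
  also have "\<dots> = int (\<Prod>l\<in>#?M. fact l) * Poly_Mapping.lookup (prod_list (map (esym A monomial_weight) (type_list (part_type n P)))) m"
    unfolding sum_block_proper[OF P A] M prod lookup_of_nat_mult ..
  finally have "real_of_int (int (card {w. is_word n w \<and> block_proper P w \<and> mset w = m})) =
      real_of_int (int (\<Prod>l\<in>#?M. fact l) * Poly_Mapping.lookup (prod_list (map (esym A monomial_weight) (type_list (part_type n P)))) m)"
    by (rule arg_cong)
  then show ?thesis
    using lookup_prod_list_esym[of m "type_list (part_type n P)"] by (simp add: A_def)
qed

lemma e_pi_eq: "e_pi n P w = of_bool (is_word n w \<and> block_proper P w)"
  by (simp add: e_pi_def block_proper_def)

section \<open>Class sums of the e-coefficients and the two positivity statements\<close>

lemma type_norm_pos: "0 < type_norm \<theta>"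
proof -
  have "0 < (\<Prod>l\<in>#L. fact l :: nat)" for L :: "nat multiset"
    by (induction L) auto
  then show ?thesis by (simp add: type_norm_def)
qed

lemma sum_setparts_by_type:
  fixes g :: "nat set set \<Rightarrow> 'a :: comm_ring_1"
  assumes "1 \<le> n"
  shows "(\<Sum>P\<in>setparts n. g P * h (part_type n P)) =
    (\<Sum>\<theta>\<in>types n. (\<Sum>P | P \<in> setparts n \<and> part_type n P = \<theta>. g P) * h \<theta>)"
proof -
  have "(\<Sum>P\<in>setparts n. g P * h (part_type n P)) =
      (\<Sum>\<theta>\<in>types n. \<Sum>P | P \<in> setparts n \<and> part_type n P = \<theta>. g P * h (part_type n P))"
    by (rule sum.group[symmetric])
      (use finite_setparts finite_types part_type_in_types[OF _ assms] in auto)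
  also have "\<dots> = (\<Sum>\<theta>\<in>types n. (\<Sum>P | P \<in> setparts n \<and> part_type n P = \<theta>. g P) * h \<theta>)"
    by (auto simp: sum_distrib_right intro!: sum.cong)
  finally show ?thesis .
qed

text \<open>The weighted sum of the proper words ending in \<open>Suc n\<close> is computed twice,
  by the cone and through the given expansion c; independence of the marked basis identifies the
  coefficients of each type.\<close>

lemma class_sums_TL:
  assumes n: "1 \<le> n" and c: "e_expansion n (Y_G n (TL n)) c"
  shows "\<exists>C. (\<forall>\<theta>. 0 \<le> C \<theta>) \<and> (\<forall>\<theta>\<in>types n.
    (\<Sum>P | P \<in> setparts n \<and> part_type n P = \<theta>. c P) = C \<theta> / real (type_norm \<theta>))"
proof -
  \<comment> \<open>One letter carries the prescribed marked weight, the other n letters realize the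
    prescribed values of e_1, ..., e_n.\<close>
  define A where "A = {1..Suc n}"
  interpret finite_alphabet A by unfold_locales (simp add: A_def)
  let ?x = "Suc n"
  have x: "?x \<in> A" by (simp add: A_def)
  let ?W = "{w \<in> words n A. w ! (n - 1) = ?x}"
  let ?s = "\<lambda>\<theta>. \<Sum>P | P \<in> setparts n \<and> part_type n P = \<theta>. c P"
  have finW: "finite ?W" using finite_words[OF finite_A] by simp
  obtain C where C: "\<forall>\<theta>. 0 \<le> C \<theta>" and
    C_eq: "\<forall>t. \<forall>x\<in>A. (\<Sum>w\<in>{w \<in> words n A. tl_word w \<and> w ! (n - 1) = x}. prod_list (map t w)) =
      (\<Sum>\<theta>\<in>types (Suc (n - 1)). complex_of_real (C \<theta>) * marked_basis A t x \<theta>)"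
    using spos_coeffs[OF spos_tl_words[OF n]] by auto
  have word: "is_word n w" if "w \<in> words n A" for w
    using that by (auto simp: is_word_def words_def A_def)
  have "?s \<theta> * real (type_norm \<theta>) - C \<theta> = 0" if \<theta>: "\<theta> \<in> types n" for \<theta>
  proof -
    have "complex_of_real (?s \<theta> * real (type_norm \<theta>) - C \<theta>) = 0"
    proof (rule marked_basis_independent[OF _ \<theta>])
      fix t :: "nat \<Rightarrow> complex"
      have "(\<Sum>\<theta>\<in>types n. of_real (C \<theta>) * marked_basis A t ?x \<theta>) =
          (\<Sum>w\<in>{w \<in> words n A. tl_word w \<and> w ! (n - 1) = ?x}. prod_list (map t w))"
        using C_eq x n by simp
      also have "\<dots> = (\<Sum>w\<in>?W. of_real (Y_G n (TL n) w) * prod_list (map t w))"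
      proof (rule sum.mono_neutral_cong_left[OF finW])
        fix w assume "w \<in> {w \<in> words n A. tl_word w \<and> w ! (n - 1) = ?x}"
        then show "prod_list (map t w) = of_real (Y_G n (TL n) w) * prod_list (map t w)"
          using word[of w] by (simp add: Y_G_def proper_word_TL_iff words_def)
      next
        show "\<forall>w\<in>?W - {w \<in> words n A. tl_word w \<and> w ! (n - 1) = ?x}.
            of_real (Y_G n (TL n) w) * prod_list (map t w) = 0"
          by (auto simp: Y_G_def proper_word_TL_iff words_def)
      qed auto
      also have "\<dots> = (\<Sum>w\<in>?W. \<Sum>P\<in>setparts n. of_real (c P) * (of_real (e_pi n P w) * prod_list (map t w)))"
        using c by (simp add: e_expansion_def sum_distrib_right mult.assoc)
      also have "\<dots> = (\<Sum>P\<in>setparts n. of_real (c P) * (\<Sum>w\<in>?W. of_real (e_pi n P w) * prod_list (map t w)))"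
        by (subst sum.swap) (simp add: sum_distrib_left)
      also have "\<dots> = (\<Sum>P\<in>setparts n. of_real (c P) *
          (of_nat (type_norm (part_type n P)) * marked_basis A t ?x (part_type n P)))"
      proof (intro sum.cong refl arg_cong2[of _ _ _ _ "(*)"])
        fix P assume P: "P \<in> setparts n"
        have "(\<Sum>w\<in>?W. of_real (e_pi n P w) * prod_list (map t w)) =
            (\<Sum>w | w \<in> words n A \<and> block_proper P w \<and> w ! (n - 1) = ?x. prod_list (map t w))"
          by (rule sum.mono_neutral_cong_right[OF finW]) (auto simp: e_pi_eq word)
        then show "(\<Sum>w\<in>?W. of_real (e_pi n P w) * prod_list (map t w)) =
            of_nat (type_norm (part_type n P)) * marked_basis A t ?x (part_type n P)"
          using sum_block_proper_marked[OF P finite_A n x, of t] by simp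
      qed
      also have "\<dots> = (\<Sum>\<theta>\<in>types n. (\<Sum>P | P \<in> setparts n \<and> part_type n P = \<theta>. of_real (c P)) *
          (of_nat (type_norm \<theta>) * marked_basis A t ?x \<theta>))"
        by (rule sum_setparts_by_type[OF n])
      finally have "(\<Sum>\<theta>\<in>types n. of_real (C \<theta>) * marked_basis A t ?x \<theta>) =
          (\<Sum>\<theta>\<in>types n. of_real (?s \<theta>) * (of_nat (type_norm \<theta>) * marked_basis A t ?x \<theta>))"
        by simp
      then show "(\<Sum>\<theta>\<in>types n. of_real (?s \<theta> * real (type_norm \<theta>) - C \<theta>) *
          marked_basis {1..Suc n} t ?x \<theta>) = 0"
        unfolding A_def[symmetric] of_real_diff of_real_mult left_diff_distrib sum_subtractf
        by (simp add: mult.assoc)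
    qed
    then show ?thesis by (simp only: of_real_eq_0_iff)
  qed
  then show ?thesis
    using C type_norm_pos by (intro exI[of _ C]) (auto simp: eq_divide_eq)
qed

theorem mainTheorem11:
  fixes n :: nat
  assumes "n \<ge> 1"
  shows "semi_sym_e_positive n (Y_G n (TL n)) \<and> e_positive n (X_G n (TL n))"
proof
  obtain c where c: "e_expansion n (Y_G n (TL n)) c" using Y_G_e_expansion by blast
  let ?class = "\<lambda>\<theta>. {P. P \<in> setparts n \<and> part_type n P = \<theta>}"
  obtain C where C: "\<And>\<theta>. 0 \<le> C \<theta>"
    and sums: "\<And>\<theta>. \<theta> \<in> types n \<Longrightarrow> (\<Sum>P\<in>?class \<theta>. c P) = C \<theta> / real (type_norm \<theta>)"
    using class_sums_TL[OF assms c] by auto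
  have fin: "finite (?class \<theta>)" for \<theta> using finite_setparts by simp
  \<comment> \<open>Each class sum is spread evenly over its class. For an empty class, division by
    0 yields 0, so d is nonnegative everywhere.\<close>
  define d where "d P = C (part_type n P) / real (type_norm (part_type n P)) / real (card (?class (part_type n P)))"
    for P
  show "semi_sym_e_positive n (Y_G n (TL n))"
    unfolding semi_sym_e_positive_def equiv_coeffs_def
  proof (intro exI conjI ballI allI)
    show "e_expansion n (Y_G n (TL n)) c" by (rule c)
    show "0 \<le> d P" for P using C by (simp add: d_def)
    fix Q assume Q: "Q \<in> setparts n"
    let ?\<theta> = "part_type n Q"
    have cl: "{P \<in> setparts n. sim_part n P Q} = ?class ?\<theta>"
      using sim_part_iff[OF _ Q assms] by auto
    have "(\<Sum>P\<in>?class ?\<theta>. d P) = (\<Sum>P\<in>?class ?\<theta>. C ?\<theta> / real (type_norm ?\<theta>) / real (card (?class ?\<theta>)))"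
      by (intro sum.cong refl) (auto simp: d_def)
    also have "\<dots> = C ?\<theta> / real (type_norm ?\<theta>)"
    proof -
      have "card (?class ?\<theta>) \<noteq> 0" using fin[of ?\<theta>] Q by auto
      then show ?thesis by simp
    qed
    finally show "(\<Sum>P\<in>{P \<in> setparts n. sim_part n P Q}. c P) = (\<Sum>P\<in>{P \<in> setparts n. sim_part n P Q}. d P)"
      unfolding cl using sums[OF part_type_in_types[OF Q assms]] by simp
  qed
  \<comment> \<open>In commuting variables e_pi becomes e_lambda times the product of the factorials
    of all block sizes. On \<open>types n\<close>, compared with \<open>type_norm\<close> this
    leaves the marked part as a factor.\<close>
  define b where "b \<theta> = C \<theta> / real (type_norm \<theta>) * real (\<Prod>l\<in>#type_mset \<theta>. fact l)" for \<theta>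
  have b: "0 \<le> b \<theta>" for \<theta> using C by (simp add: b_def)
  show "e_positive n (X_G n (TL n))"
    unfolding e_positive_def
  \<comment> \<open>Several types differ only in which part is marked; the coefficient of e_lambda
    collects all of them.\<close>
  proof (intro exI conjI allI ext)
    show "0 \<le> (\<Sum>\<theta> | \<theta> \<in> types n \<and> type_list \<theta> = l. b \<theta>)" for l
      by (intro sum_nonneg b)
    fix m
    let ?W = "{w. is_word n w \<and> mset w = m}"
    have "?W \<subseteq> {w. set w \<subseteq> set_mset m \<and> length w = n}" by (auto simp: is_word_def)
    then have finW: "finite ?W" by (rule finite_subset) (intro finite_lists_length_eq; simp)
    have card: "(\<Sum>w\<in>?W. of_bool (R w)) = real (card {w. is_word n w \<and> R w \<and> mset w = m})" for R
    proof -
      have "?W \<inter> {w. R w} = {w. is_word n w \<and> R w \<and> mset w = m}" by auto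
      then show ?thesis using finW by (simp add: of_bool_def sum.If_cases)
    qed
    have "X_G n (TL n) m = (\<Sum>w\<in>?W. Y_G n (TL n) w)"
      unfolding X_G_def card[symmetric] by (intro sum.cong) (auto simp: Y_G_def)
    also have "\<dots> = (\<Sum>P\<in>setparts n. c P * (\<Sum>w\<in>?W. e_pi n P w))"
      using c unfolding e_expansion_def by (simp only:) (subst sum.swap, simp add: sum_distrib_left)
    also have "\<dots> = (\<Sum>P\<in>setparts n. c P * (real (\<Prod>l\<in>#type_mset (part_type n P). fact l) *
        e_lambda (type_list (part_type n P)) m))"
    proof (intro sum.cong refl arg_cong2[of _ _ _ _ "(*)"])
      fix P assume P: "P \<in> setparts n"
      have "(\<Sum>w\<in>?W. e_pi n P w) = (\<Sum>w\<in>?W. of_bool (block_proper P w))"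
        by (intro sum.cong) (auto simp: e_pi_eq)
      then show "(\<Sum>w\<in>?W. e_pi n P w) = real (\<Prod>l\<in>#type_mset (part_type n P). fact l) *
          e_lambda (type_list (part_type n P)) m"
        unfolding card card_block_proper[OF P assms] .
    qed
    also have "\<dots> = (\<Sum>\<theta>\<in>types n. (\<Sum>P\<in>?class \<theta>. c P) *
        (real (\<Prod>l\<in>#type_mset \<theta>. fact l) * e_lambda (type_list \<theta>) m))"
      by (rule sum_setparts_by_type[OF assms])
    also have "\<dots> = (\<Sum>\<theta>\<in>types n. b \<theta> * e_lambda (type_list \<theta>) m)"
      using sums by (intro sum.cong refl) (simp add: b_def)
    also have "\<dots> = (\<Sum>l | int_partition n l. \<Sum>\<theta> | \<theta> \<in> types n \<and> type_list \<theta> = l.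
        b \<theta> * e_lambda (type_list \<theta>) m)"
      by (rule sum.group[symmetric])
        (use finite_types finite_int_partitions int_partition_type_list in auto)
    also have "\<dots> = (\<Sum>l | int_partition n l. (\<Sum>\<theta> | \<theta> \<in> types n \<and> type_list \<theta> = l. b \<theta>) * e_lambda l m)"
      by (auto simp: sum_distrib_right intro!: sum.cong)
    finally show "X_G n (TL n) m =
        (\<Sum>l | int_partition n l. (\<Sum>\<theta> | \<theta> \<in> types n \<and> type_list \<theta> = l. b \<theta>) * e_lambda l m)" .
  qed
qed

end
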